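(* Let $n\ge 2$, and let $T,\lambda\in\mathbb{C}$ with $e^{-\lambda}\neq \pm 1$. Define the partition function $$Z(\lambda,T):=\sum_{k\ge 0}\sum_{0\le \ell\le n}T^{nk}e^{-\lambda \ell}\,\mathrm{Vol}^{(n)}_{k,\ell}.$$ Then $$Z(\lambda,T)=\sum_{\theta=(\theta_1,\theta_2)\in\{0,1\}^2}c_\theta^{\lambda,n}\,\det\left(I+T\,C^{\lambda+\theta_1\pi\iota,\,\theta_2}\right),$$ where $\det(I+T\,C)$ is the Fredholm determinant on $\mathbb{T}_n$, where for $\beta\in\mathbb{C}$ with $e^{-\beta}\ne 1$ and $\theta_2\in\{0,1\}$ the operator $C^{\beta,\theta_2}:\mathbb{T}_n\times\mathbb{T}_n\to\mathbb{C}$ is $$C^{\beta,\theta_2}\big((t,h),(t',h')\big)=e^{\theta_2\pi\iota/n}\,\mathbf{1}_{\{h'=h+1\}}\,\frac{e^{-\beta[t'-t]}}{1-e^{-\beta}},\qquad [t'-t]:=t'-t+\mathbf{1}_{\{t'<t\}},$$ with $h'=h+1$ understood mod $n$, and where $$c_\theta^{\lambda,n}:=\tfrac12(-1)^{(\theta_1+1)(\theta_2+n+1)}\left(1-(-1)^{\theta_1}e^{-\lambda}\right)^n .$$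
   Context: $\iota=\sqrt{-1}$. $\mathbb{Z}_n=\mathbb{Z}/n\mathbb{Z}=\{0,\ldots,n-1\}$ and $\mathbb{T}_n=[0,1)\times\mathbb{Z}_n$ ($n$ parallel unit-length strings, string $h$ being $[0,1)\times\{h\}$); arithmetic on string labels is mod $n$. Bead configuration: for $k\ge1$, a collection of $nk$ distinct points of $\mathbb{T}_n$ with exactly $k$ points on each string such that for every $h\in\mathbb{Z}_n$, if $t_1<\cdots<t_k$ and $t_1'<\cdots<t_k'$ are the horizontal coordinates of the points on strings $h$ and $h+1$, then either $t_1\le t_1'<t_2\le t_2'<\cdots<t_k\le t_k'$ or $t_1'<t_1\le t_2'<t_2\le\cdots\le t_k'<t_k$. Occupation number: $\ell:=\#\{h\in\mathbb{Z}_n:\ \text{the smallest horizontal coordinate on string }h\text{ is strictly less than that on string }h-1\}$. Volumes: for $k\ge1$ and $0\le\ell\le n$, identify a bead configuration with the array $(t_{h,j})_{0\le h\le n-1,1\le j\le k}\in[0,1)^{nk}$, where $t_{h,j}$ is the horizontal coordinate of the $j$-th bead (in increasing order) on string $h$, and let $\mathrm{Vol}^{(n)}_{k,\ell}$ be the $nk$-dimensional Lebesgue measure of the set of arrays of bead configurations with $k$ beads per string and occupation number $\ell$. Also $\mathrm{Vol}^{(n)}_{0,\ell}:=\binom{n}{\ell}$ for $0\le\ell\le n$. $\mathrm{d}y$ is the measure on $\mathbb{T}_n$ giving mass $b-a$ to $(a,b]\times\{h\}$. For $C:\mathbb{T}_n\times\mathbb{T}_n\to\mathbb{C}$, the Fredholm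 determinant is $$\det(I+TC):=\sum_{N=0}^\infty\frac{T^N}{N!}\int_{\mathbb{T}_n^N}\det_{i,j=1}^N C(y_i,y_j)\,\mathrm{d}y_1\cdots\mathrm{d}y_N .$$ *)

theory Defs
  imports
    "HOL-Analysis.Analysis"
    "Jordan_Normal_Form.Determinant"
begin

text \<open>The string labels \<open>\<int>/n\<close> are represented by \<open>{..<n}\<close>; on them, \<open>h + 1\<close> and \<open>h - 1\<close> are
  \<open>(h + 1) mod n\<close> and \<open>(h + n - 1) mod n\<close>.\<close>

definition torus :: "nat \<Rightarrow> (real \<times> nat) set" where
  "torus n = {0..<1} \<times> {..<n}"

definition string_points :: "(real \<times> nat) set \<Rightarrow> nat \<Rightarrow> real set" where
  "string_points S h = {t. (t, h) \<in> S}"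

text \<open>The \<open>j\<close>-th smallest coordinate on string \<open>h\<close>, counting from \<open>j = 1\<close>.\<close>

definition bead :: "(real \<times> nat) set \<Rightarrow> nat \<Rightarrow> nat \<Rightarrow> real" where
  "bead S h j = sorted_list_of_set (string_points S h) ! (j - 1)"

definition interlaced :: "nat \<Rightarrow> (nat \<Rightarrow> real) \<Rightarrow> (nat \<Rightarrow> real) \<Rightarrow> bool" where
  "interlaced k t t' \<longleftrightarrow>
     (\<forall>j\<in>{1..k}. t j \<le> t' j) \<and> (\<forall>j\<in>{1..<k}. t' j < t (j + 1)) \<or>
     (\<forall>j\<in>{1..k}. t' j < t j) \<and> (\<forall>j\<in>{1..<k}. t j \<le> t' (j + 1))"

definition bead_config :: "nat \<Rightarrow> nat \<Rightarrow> (real \<times> nat) set \<Rightarrow> bool" where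
  "bead_config n k S \<longleftrightarrow>
     S \<subseteq> torus n \<and>
     (\<forall>h<n. finite (string_points S h) \<and> card (string_points S h) = k) \<and>
     (\<forall>h<n. interlaced k (bead S h) (bead S ((h + 1) mod n)))"

definition occupation :: "nat \<Rightarrow> (real \<times> nat) set \<Rightarrow> nat" where
  "occupation n S =
     card {h. h < n \<and> Min (string_points S h) < Min (string_points S ((h + n - 1) mod n))}"

definition bead_array :: "nat \<Rightarrow> nat \<Rightarrow> (real \<times> nat) set \<Rightarrow> nat \<times> nat \<Rightarrow> real" where
  "bead_array n k S = (\<lambda>(h, j)\<in>{..<n} \<times> {1..k}. bead S h j)"

definition bead_arrays :: "nat \<Rightarrow> nat \<Rightarrow> nat \<Rightarrow> (nat \<times> nat \<Rightarrow> real) set" where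
  "bead_arrays n k l = bead_array n k ` {S. bead_config n k S \<and> occupation n S = l}"

definition bead_vol :: "nat \<Rightarrow> nat \<Rightarrow> nat \<Rightarrow> real" where
  "bead_vol n k l =
     (if k = 0 then real (n choose l)
      else measure (PiM ({..<n} \<times> {1..k}) (\<lambda>_. lborel)) (bead_arrays n k l))"

definition partition_term :: "nat \<Rightarrow> complex \<Rightarrow> complex \<Rightarrow> nat \<Rightarrow> complex" where
  "partition_term n lam T k =
     (\<Sum>l\<le>n. T ^ (n * k) * exp (- lam * of_nat l) * of_real (bead_vol n k l))"

definition partition_function :: "nat \<Rightarrow> complex \<Rightarrow> complex \<Rightarrow> complex" where
  "partition_function n lam T = (\<Sum>k. partition_term n lam T k)"

definition torus_measure :: "nat \<Rightarrow> (real \<times> nat) measure" where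
  "torus_measure n = restrict_space lborel {0..<1} \<Otimes>\<^sub>M count_space {..<n}"

definition kernel_det ::
  "(real \<times> nat \<Rightarrow> real \<times> nat \<Rightarrow> complex) \<Rightarrow> nat \<Rightarrow> (nat \<Rightarrow> real \<times> nat) \<Rightarrow> complex" where
  "kernel_det C N y = Determinant.det (Matrix.mat N N (\<lambda>(i, j). C (y i) (y j)))"

definition fredholm_term ::
  "nat \<Rightarrow> complex \<Rightarrow> (real \<times> nat \<Rightarrow> real \<times> nat \<Rightarrow> complex) \<Rightarrow> nat \<Rightarrow> complex" where
  "fredholm_term n T C N =
     T ^ N / fact N * (LINT y|PiM {..<N} (\<lambda>_. torus_measure n). kernel_det C N y)"

definition fredholm_det ::
  "nat \<Rightarrow> complex \<Rightarrow> (real \<times> nat \<Rightarrow> real \<times> nat \<Rightarrow> complex) \<Rightarrow> complex" where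
  "fredholm_det n T C = (\<Sum>N. fredholm_term n T C N)"

text \<open>Integrals and infinite sums are total in HOL; this says that those in the Fredholm expansion
  are not default values.\<close>

definition fredholm_converges ::
  "nat \<Rightarrow> complex \<Rightarrow> (real \<times> nat \<Rightarrow> real \<times> nat \<Rightarrow> complex) \<Rightarrow> bool" where
  "fredholm_converges n T C \<longleftrightarrow>
     (\<forall>N. integrable (PiM {..<N} (\<lambda>_. torus_measure n)) (kernel_det C N)) \<and>
     summable (\<lambda>N. norm (fredholm_term n T C N))"

definition cyclic_diff :: "real \<Rightarrow> real \<Rightarrow> real" where
  "cyclic_diff t t' = t' - t + of_bool (t' < t)"

definition bead_kernel ::
  "nat \<Rightarrow> complex \<Rightarrow> nat \<Rightarrow> real \<times> nat \<Rightarrow> real \<times> nat \<Rightarrow> complex" where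
  "bead_kernel n \<beta> \<theta>2 = (\<lambda>(t, h) (t', h').
     exp (of_nat \<theta>2 * of_real pi * \<i> / of_nat n) * of_bool (h' = (h + 1) mod n) *
     (exp (- \<beta> * of_real (cyclic_diff t t')) / (1 - exp (- \<beta>))))"

definition theta_coeff :: "nat \<Rightarrow> complex \<Rightarrow> nat \<Rightarrow> nat \<Rightarrow> complex" where
  "theta_coeff n lam \<theta>1 \<theta>2 =
     1 / 2 * (- 1) ^ ((\<theta>1 + 1) * (\<theta>2 + n + 1)) * (1 - (- 1) ^ \<theta>1 * exp (- lam)) ^ n"

lemma bead_image:
  assumes "\<And>j. j \<in> {1..<k} \<Longrightarrow> x j < (x (j + 1) :: real)" and "j \<in> {1..k}"
  shows "sorted_list_of_set (x ` {1..k}) ! (j - 1) = x j" and "card (x ` {1..k}) = k"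
proof -
  have mono: "x i < x i'" if "1 \<le> i" "i < i'" "i' \<le> k" for i i'
    using that(2,3)
  proof (induction i' rule: less_induct)
    case (less m)
    then obtain m' where m: "m = Suc m'" by (cases m) auto
    have step: "x m' < x m" using assms(1)[of m'] less.prems that(1) by (auto simp: m)
    show ?case
    proof (cases "i = m'")
      case False
      then have "x i < x m'" using less.prems by (intro less.IH) (auto simp: m)
      then show ?thesis using step by simp
    qed (use step in simp)
  qed
  have inj: "inj_on x {1..k}"
    by (rule linorder_inj_onI) (use mono in \<open>fastforce+\<close>)
  then show "card (x ` {1..k}) = k" by (simp add: card_image)
  have srt: "sorted (map x [1..<k+1])"
    unfolding sorted_iff_nth_mono_less using mono by (force simp del: upt_Suc intro: less_imp_le)
  have "set (map x [1..<k+1]) = x ` {1..k}"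
    by (simp add: atLeastLessThanSuc_atLeastAtMost del: upt_Suc)
  moreover have "distinct (map x [1..<k+1])"
    using inj by (simp add: distinct_map atLeastLessThanSuc_atLeastAtMost del: upt_Suc)
  ultimately have "sorted_list_of_set (x ` {1..k}) = map x [1..<k+1]"
    using srt sorted_list_of_set.idem_if_sorted_distinct by metis
  moreover have "j - 1 < length [1..<k+1]" and "[1..<k+1] ! (j - 1) = j"
    using assms(2) by (auto simp: nth_upt simp del: upt_Suc)
  ultimately show "sorted_list_of_set (x ` {1..k}) ! (j - 1) = x j"
    by (metis nth_map)
qed

lemma bead_arrays_eq:
  assumes "n \<ge> 1" "k \<ge> 1"
  shows "bead_arrays n k l = {x \<in> ({..<n} \<times> {1..k}) \<rightarrow>\<^sub>E {0..<1}.
    (\<forall>h<n. \<forall>j\<in>{1..<k}. x (h, j) < x (h, j + 1)) \<and>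
    (\<forall>h<n. interlaced k (\<lambda>j. x (h, j)) (\<lambda>j. x ((h + 1) mod n, j))) \<and>
    card {h. h < n \<and> x (h, 1) < x ((h + n - 1) mod n, 1)} = l}" (is "_ = ?R")
proof (intro equalityI subsetI)
  fix x assume "x \<in> bead_arrays n k l"
  then obtain S where S: "bead_config n k S" "occupation n S = l" and x: "x = bead_array n k S"
    unfolding bead_arrays_def by auto
  have fin: "finite (string_points S h)" and card: "card (string_points S h) = k" if "h < n" for h
    using S(1) that by (auto simp: bead_config_def)
  have xb: "x (h, j) = bead S h j" if "h < n" "j \<in> {1..k}" for h j
    using that by (auto simp: x bead_array_def)
  have pts: "bead S h j \<in> string_points S h" if "h < n" "j \<in> {1..k}" for h j
  proof -
    have "sorted_list_of_set (string_points S h) ! (j - 1) \<in> set (sorted_list_of_set (string_points S h))"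
      using that card[OF that(1)] by (intro nth_mem) auto
    then show ?thesis using fin[OF that(1)] by (simp add: bead_def)
  qed
  have inc: "bead S h j < bead S h (j + 1)" if "h < n" "j \<in> {1..<k}" for h j
    unfolding bead_def
    by (rule sorted_wrt_nth_less[OF strict_sorted_list_of_set]) (use that card[OF that(1)] in auto)
  have mn: "Min (string_points S h) = x (h, 1)" if "h < n" for h
  proof -
    have ne: "string_points S h \<noteq> {}" using card[OF that] assms(2) by auto
    have "sorted_list_of_set (string_points S h) ! 0 = Min (string_points S h)"
      using sorted_list_of_set_nonempty[OF fin[OF that] ne] by simp
    then show ?thesis using xb[OF that, of 1] assms(2) by (simp add: bead_def)
  qed
  have "x \<in> ({..<n} \<times> {1..k}) \<rightarrow>\<^sub>E {0..<1}"
  proof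
    fix p assume "p \<in> {..<n} \<times> {1..k}"
    then obtain h j where p: "p = (h, j)" "h < n" "j \<in> {1..k}" by auto
    have "(bead S h j, h) \<in> torus n"
      using pts[OF p(2,3)] S(1) by (auto simp: bead_config_def string_points_def)
    then show "x p \<in> {0..<1}" using xb[OF p(2,3)] p(1) by (auto simp: torus_def)
  qed (auto simp: x bead_array_def)
  moreover have "\<forall>h<n. interlaced k (\<lambda>j. x (h, j)) (\<lambda>j. x ((h + 1) mod n, j))"
    using S(1) assms(1) unfolding bead_config_def interlaced_def by (auto simp: xb)
  moreover have "{h. h < n \<and> Min (string_points S h) < Min (string_points S ((h + n - 1) mod n))}
      = {h. h < n \<and> x (h, 1) < x ((h + n - 1) mod n, 1)}"
    using assms(1) by (intro Collect_cong conj_cong refl) (simp add: mn)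
  ultimately show "x \<in> ?R"
    using inc S(2) by (simp add: xb occupation_def)
next
  fix x assume x: "x \<in> ?R"
  define S where "S = {(t, h). h < n \<and> t \<in> (\<lambda>j. x (h, j)) ` {1..k}}"
  have sp: "string_points S h = (\<lambda>j. x (h, j)) ` {1..k}" if "h < n" for h
    using that by (auto simp: string_points_def S_def)
  have bd: "bead S h j = x (h, j)" if "h < n" "j \<in> {1..k}" for h j
    unfolding bead_def sp[OF that(1)]
    using bead_image(1)[of k "\<lambda>j. x (h, j)" j] x that by auto
  have card: "card (string_points S h) = k" if "h < n" for h
    unfolding sp[OF that] by (rule bead_image(2)[of k "\<lambda>j. x (h, j)" 1]) (use x that assms(2) in auto)
  have mn: "Min (string_points S h) = x (h, 1)" if "h < n" for h
  proof -
    have "string_points S h \<noteq> {}" "finite (string_points S h)" using sp[OF that] assms(2) by auto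
    then have "sorted_list_of_set (string_points S h) ! 0 = Min (string_points S h)"
      using sorted_list_of_set_nonempty by fastforce
    then show ?thesis using bd[OF that, of 1] assms(2) by (simp add: bead_def)
  qed
  have "S \<subseteq> torus n" using x by (auto simp: S_def torus_def Pi_iff PiE_iff)
  moreover have "\<forall>h<n. interlaced k (bead S h) (bead S ((h + 1) mod n))"
    using x assms(1) unfolding interlaced_def by (auto simp: bd)
  ultimately have "bead_config n k S"
    using card sp by (auto simp: bead_config_def)
  moreover have "{h. h < n \<and> Min (string_points S h) < Min (string_points S ((h + n - 1) mod n))}
      = {h. h < n \<and> x (h, 1) < x ((h + n - 1) mod n, 1)}"
    using assms(1) by (intro Collect_cong conj_cong refl) (simp add: mn)
  then have "occupation n S = l" using x by (simp add: occupation_def)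
  moreover have "x = bead_array n k S"
  proof
    fix p show "x p = bead_array n k S p"
      using x bd by (cases p) (auto simp: bead_array_def PiE_iff extensional_def)
  qed
  ultimately show "x \<in> bead_arrays n k l" unfolding bead_arrays_def by blast
qed

text \<open>So \<^const>\<open>measure\<close> in \<^const>\<open>bead_vol\<close> is the Lebesgue measure of a Borel set.\<close>

lemma bead_arrays_measurable:
  assumes "n \<ge> 1" "k \<ge> 1"
  shows "bead_arrays n k l \<in> sets (PiM ({..<n} \<times> {1..k}) (\<lambda>_. lborel))"
proof -
  let ?M = "PiM ({..<n} \<times> {1..k}) (\<lambda>_. lborel :: real measure)"
  have comp [measurable]: "(\<lambda>x. x (h, j)) \<in> borel_measurable ?M" if "h < n" "j \<in> {1..k}" for h j
    using measurable_component_singleton[of "(h, j)" "{..<n} \<times> {1..k}" "\<lambda>_. lborel"] that by simp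
  have md: "m mod n < n" for m using assms(1) by simp
  have less: "Measurable.pred ?M (\<lambda>x. f x < g x)"
    and le: "Measurable.pred ?M (\<lambda>x. f x \<le> g x)"
    if "f \<in> borel_measurable ?M" "g \<in> borel_measurable ?M" for f g :: "_ \<Rightarrow> real"
    unfolding pred_def by (rule borel_measurable_less[OF that] borel_measurable_le[OF that])+
  have P1: "Measurable.pred ?M (\<lambda>x. \<forall>h\<in>{..<n}. \<forall>j\<in>{1..<k}. x (h, j) < x (h, j + 1))"
    by (intro pred_intros_finite less comp) auto
  have P2: "Measurable.pred ?M
      (\<lambda>x. \<forall>h\<in>{..<n}. interlaced k (\<lambda>j. x (h, j)) (\<lambda>j. x ((h + 1) mod n, j)))"
    unfolding interlaced_def
    by (intro pred_intros_finite pred_intros_logic less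
        le comp) (auto simp: md)
  have P3: "Measurable.pred ?M
      (\<lambda>x. \<exists>A\<in>{A. A \<subseteq> {..<n} \<and> card A = l}. \<forall>h\<in>{..<n}. (h \<in> A) = (x (h, 1) < x ((h + n - 1) mod n, 1)))"
    by (intro pred_intros_finite pred_intros_logic less comp)
      (use assms in \<open>auto simp: md\<close>)
  have P4: "Measurable.pred ?M (\<lambda>x. \<forall>p\<in>{..<n} \<times> {1..k}. 0 \<le> x p \<and> x p < 1)"
    by (intro pred_intros_finite pred_intros_logic less le) (use comp in auto)
  have *: "(card {h. h < n \<and> Q h} = l) \<longleftrightarrow>
      (\<exists>A\<in>{A. A \<subseteq> {..<n} \<and> card A = l}. \<forall>h\<in>{..<n}. (h \<in> A) = Q h)" (is "?a \<longleftrightarrow> ?b")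
    for Q :: "nat \<Rightarrow> bool"
  proof
    assume ?a then show ?b by (intro bexI[of _ "{h. h < n \<and> Q h}"]) auto
  next
    assume ?b
    then obtain A where A: "A \<subseteq> {..<n}" "card A = l" "\<forall>h\<in>{..<n}. (h \<in> A) = Q h" by auto
    then have "A = {h. h < n \<and> Q h}" by auto
    then show ?a using A by simp
  qed
  have "bead_arrays n k l = {x \<in> space ?M.
     (\<forall>h\<in>{..<n}. \<forall>j\<in>{1..<k}. x (h, j) < x (h, j + 1)) \<and>
     (\<forall>h\<in>{..<n}. interlaced k (\<lambda>j. x (h, j)) (\<lambda>j. x ((h + 1) mod n, j))) \<and>
     (\<exists>A\<in>{A. A \<subseteq> {..<n} \<and> card A = l}. \<forall>h\<in>{..<n}. (h \<in> A) = (x (h, 1) < x ((h + n - 1) mod n, 1))) \<and>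
     (\<forall>p\<in>{..<n} \<times> {1..k}. 0 \<le> x p \<and> x p < 1)}"
    unfolding bead_arrays_eq[OF assms] * space_PiM by (auto simp: PiE_iff)
  also have "\<dots> \<in> sets ?M"
    by (rule predE, intro pred_intros_logic P1 P2 P3 P4)
  finally show ?thesis .
qed

end

theory Submission
  imports Defs
begin

text \<open>
  Put \<open>q = exp (- \<beta>)\<close>. Up to a factor that is constant on the torus, the determinant in the Fredholm
  expansion does not feel the exponentials: conjugating the kernel by \<open>exp (- \<beta> * t)\<close> leaves
  \<open>1\<close> or \<open>q\<close>, according to the order of the two coordinates, for points on consecutive strings
  (\<open>kernel_det_bead_kernel\<close>).

  A nonzero determinant needs a permutation of the points that always moves to the next string.
  Hence all strings carry the same number \<open>k\<close> of points, and only terms with \<open>N = n * k\<close> survive. The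
  determinant is symmetric in the points and vanishes when two of them coincide, so the \<open>N!\<close> of the
  expansion cancels when the points are listed string by string from left to right
  (\<open>integral_symmetric_function\<close>). In this order the matrix is block cyclic. The block for two
  consecutive strings has entries \<open>q\<close> to the left of a staircase and ones to the right of it, and such a
  determinant is nonzero only if each row is one step longer than the previous one, without a jump
  in the middle. These are exactly the two interlacing patterns (\<open>det_interlacing\<close>): the block is
  \<open>(1 - q) ^ (k - 1)\<close> for the first and \<open>(-1) ^ (k - 1) * q * (1 - q) ^ (k - 1)\<close> for the second, and
  the occupation number counts the second pattern. So the determinant is supported on bead
  configurations and, for \<open>k > 0\<close>, the Fredholm term of order \<open>n * k\<close> equals
  \<open>T ^ (n * k) * (-1) ^ ((\<theta>2 + n + 1) * k) / (1 - q) ^ n\<close> times the sum over \<open>l\<close> of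
  \<open>((-1) ^ (k - 1) * q) ^ l\<close> times the volume of occupation number \<open>l\<close> (\<open>fredholm_term_bead_kernel\<close>).

  This is the partition function up to signs that depend on the parities of \<open>k\<close> and \<open>l\<close>. Shifting
  \<open>lam\<close> by \<open>\<theta>1 * pi * \<i>\<close> multiplies \<open>q\<close> by \<open>(-1) ^ \<theta>1\<close>, and the coefficients
  \<^const>\<open>theta_coeff\<close> are chosen so that the signs cancel by orthogonality of characters of the group
  with two elements (\<open>spin_sum\<close>).

  Convergence is governed by \<open>measure_increasing_points\<close>: the increasing tuples of \<open>N\<close> points have measure at
  most \<open>n ^ N / N!\<close>, which bounds the volumes and hence the terms of both expansions by those of an
  exponential series.
\<close>

section \<open>Kernel determinants\<close>

text \<open>The combinatorial core of \<^const>\<open>bead_kernel\<close>: with \<open>q = exp (- \<beta>)\<close>, the exponential of a cyclic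
  difference is \<open>exp (- \<beta> * t') / exp (- \<beta> * t)\<close>, times \<open>q\<close> when the way from \<open>t\<close> to \<open>t'\<close> wraps around.
  Only this last factor survives in determinants.\<close>

definition step_kernel :: "nat \<Rightarrow> complex \<Rightarrow> real \<times> nat \<Rightarrow> real \<times> nat \<Rightarrow> complex" where
  "step_kernel n q = (\<lambda>(t, h) (t', h'). of_bool (h' = (h + 1) mod n) * (if t' < t then q else 1))"

lemma kernel_det_expand:
  "kernel_det C N y = (\<Sum>p | p permutes {..<N}. signof p * (\<Prod>i<N. C (y i) (y (p i))))"
proof -
  have "(\<Prod>i = 0..<N. Matrix.mat N N (\<lambda>(i, j). C (y i) (y j)) $$ (i, p i)) = (\<Prod>i<N. C (y i) (y (p i)))"
    if "p permutes {0..<N}" for p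
    using that by (intro prod.cong) (auto dest: permutes_in_image[of p _ ] simp: atLeast0LessThan permutes_in_image)
  then show ?thesis
    unfolding kernel_det_def det_def by (auto simp: atLeast0LessThan intro!: sum.cong)
qed

text \<open>Conjugation by the diagonal matrix of the values of \<open>g\<close> does not change a determinant.\<close>

lemma kernel_det_gauge:
  assumes "\<And>a b. C a b = c * (g b / g a) * C' a b" and "\<And>a. g a \<noteq> 0"
  shows "kernel_det C N y = c ^ N * kernel_det C' N y"
proof -
  have "(\<Prod>i<N. C (y i) (y (p i))) = c ^ N * (\<Prod>i<N. C' (y i) (y (p i)))"
    if "p permutes {..<N}" for p
  proof -
    have "(\<Prod>i<N. g (y (p i))) = (\<Prod>i<N. g (y i))"
      using prod.permute[OF that, of "\<lambda>i. g (y i)"] by (simp add: o_def)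
    moreover have "(\<Prod>i<N. g (y i)) \<noteq> 0" using assms(2) by simp
    ultimately show ?thesis by (simp add: assms(1) prod.distrib prod_dividef)
  qed
  then show ?thesis
    unfolding kernel_det_expand sum_distrib_left by (intro sum.cong) auto
qed

text \<open>After removing the gauge factor \<open>exp (- \<beta> * t)\<close>, the integrand of the Fredholm expansion depends only
  on the strings and on the relative order of the coordinates, so it is piecewise constant.\<close>

lemma kernel_det_bead_kernel:
  "kernel_det (bead_kernel n \<beta> \<theta>) N y =
    (exp (of_nat \<theta> * of_real pi * \<i> / of_nat n) / (1 - exp (- \<beta>))) ^ N *
    kernel_det (step_kernel n (exp (- \<beta>))) N y"
proof (rule kernel_det_gauge[where g = "\<lambda>a. exp (- \<beta> * of_real (fst a))"])
  fix a b :: "real \<times> nat"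
  obtain t h t' h' where ab: "a = (t, h)" "b = (t', h')" by fastforce
  have "exp (- \<beta> * of_real (cyclic_diff t t'))
      = exp (- \<beta> * of_real t') / exp (- \<beta> * of_real t) * (if t' < t then exp (- \<beta>) else 1)"
    by (auto simp: cyclic_diff_def exp_add[symmetric] exp_diff[symmetric] algebra_simps)
  then show "bead_kernel n \<beta> \<theta> a b
      = exp (of_nat \<theta> * of_real pi * \<i> / of_nat n) / (1 - exp (- \<beta>)) *
        (exp (- \<beta> * of_real (fst b)) / exp (- \<beta> * of_real (fst a))) * step_kernel n (exp (- \<beta>)) a b"
    by (simp add: ab bead_kernel_def step_kernel_def mult_ac)
qed simp

text \<open>The same permutation acts on rows and columns, so its sign appears twice.\<close>

lemma kernel_det_permute:
  assumes p: "p permutes {..<N}"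
  shows "kernel_det C N (\<lambda>i. y (p i)) = kernel_det C N y"
proof -
  have p': "p permutes {0..<N}" and pN: "p i < N \<longleftrightarrow> i < N" for i
    using p permutes_in_image[OF p] by (auto simp: atLeast0LessThan)
  let ?A = "Matrix.mat N N (\<lambda>(i, j). C (y i) (y (p j)))"
  let ?B = "Matrix.mat N N (\<lambda>(i, j). C (y j) (y i))"
  have "Matrix.mat N N (\<lambda>(i, j). C (y (p i)) (y (p j))) = Matrix.mat N N (\<lambda>(i, j). ?A $$ (p i, j))"
    using pN by (intro eq_matI) auto
  then have "kernel_det C N (\<lambda>i. y (p i)) = signof p * Determinant.det ?A"
    unfolding kernel_det_def using det_permute_rows[OF _ p', of ?A] by simp
  also have "Determinant.det ?A = Determinant.det (?A\<^sup>T)"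
    using Determinant.det_transpose[of ?A N] by simp
  also have "?A\<^sup>T = Matrix.mat N N (\<lambda>(i, j). ?B $$ (p i, j))"
    using pN by (intro eq_matI) auto
  also have "Determinant.det \<dots> = signof p * Determinant.det ?B"
    by (rule det_permute_rows[OF _ p']) simp
  also have "Determinant.det ?B = Determinant.det (?B\<^sup>T)"
    using Determinant.det_transpose[of ?B N] by simp
  also have "?B\<^sup>T = Matrix.mat N N (\<lambda>(i, j). C (y i) (y j))"
    by (intro eq_matI) auto
  finally show ?thesis
    by (cases p rule: sign_cases) (simp_all add: kernel_det_def)
qed

lemma kernel_det_coincident:
  assumes "i < N" "j < N" "i \<noteq> j" "y i = y j"
  shows "kernel_det C N y = 0"
  unfolding kernel_det_def
  by (rule Determinant.det_identical_rows[of _ N i j]) (use assms in \<open>auto intro!: eq_vecI\<close>)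

section \<open>Block, triangular and staircase determinants\<close>

lemma det_block_diagonal:
  fixes f :: "nat \<Rightarrow> nat \<Rightarrow> nat \<Rightarrow> 'a :: idom"
  assumes k: "k > 0"
  shows "Determinant.det (Matrix.mat (n * k) (n * k)
      (\<lambda>(i, j). if i div k = j div k then f (i div k) (i mod k) (j mod k) else 0)) =
    (\<Prod>h<n. Determinant.det (Matrix.mat k k (\<lambda>(i, j). f h i j)))"
proof (induction n)
  case 0
  show ?case by (simp add: det_dim_zero)
next
  case (Suc n)
  let ?M = "\<lambda>n. Matrix.mat (n * k) (n * k)
      (\<lambda>(i, j). if i div k = j div k then f (i div k) (i mod k) (j mod k) else 0)"
  have lt: "i div k < n \<longleftrightarrow> i < n * k" for i
    using k by (simp add: less_mult_imp_div_less div_less_iff_less_mult)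
  have last: "i div k = n" "i mod k = i - n * k" if "n * k \<le> i" "i < k + n * k" for i
  proof -
    define r where "r = i - n * k"
    have "i = n * k + r" "r < k" using that by (simp_all add: r_def)
    then show "i div k = n" "i mod k = i - n * k" using k by auto
  qed
  have "?M (Suc n) = four_block_mat (?M n) (0\<^sub>m (n * k) k) (0\<^sub>m k (n * k))
      (Matrix.mat k k (\<lambda>(i, j). f n i j))"
    (is "_ = ?F")
  proof (rule eq_matI)
    fix i j assume "i < dim_row ?F" "j < dim_col ?F"
    then have ij: "i < k + n * k" "j < k + n * k" by (simp_all add: add.commute)
    have small: "i div k < n" if "i < n * k" for i using that lt by blast
    show "?M (Suc n) $$ (i, j) = ?F $$ (i, j)"
    proof (cases "i < n * k"; cases "j < n * k")
      assume "i < n * k" "j < n * k"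
      then show ?thesis using ij by simp
    next
      assume "i < n * k" "\<not> j < n * k"
      then show ?thesis using ij small[of i] last[of j] by simp
    next
      assume "\<not> i < n * k" "j < n * k"
      then show ?thesis using ij small[of j] last[of i] by simp
    next
      assume "\<not> i < n * k" "\<not> j < n * k"
      then show ?thesis using ij last[of i] last[of j] by simp
    qed
  qed (simp_all add: add.commute)
  then have "Determinant.det (?M (Suc n)) = Determinant.det (?M n) * Determinant.det (Matrix.mat k k (\<lambda>(i, j). f n i j))"
    using det_four_block_mat_upper_right_zero[of "?M n" "n * k" "0\<^sub>m (n * k) k" k "0\<^sub>m k (n * k)"] by simp
  then show ?case using Suc by simp
qed

text \<open>Subtracting from each column its left neighbour leaves a lower triangular matrix with diagonal
  \<open>a, a - b, \<dots>, a - b\<close>; the proof writes this as a factorization through the matrix of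
  cumulative sums.\<close>

lemma det_two_valued_triangular:
  fixes a b :: "'a :: idom"
  assumes k: "k > 0"
  shows "Determinant.det (Matrix.mat k k (\<lambda>(i, j). if i \<le> j then a else b)) = a * (a - b) ^ (k - 1)"
proof -
  let ?Y = "Matrix.mat k k (\<lambda>(i, j). if j = 0 then if i = 0 then a else b else if i = j then a - b else 0)"
  let ?U = "Matrix.mat k k (\<lambda>(i, j). if i \<le> j then 1 else (0 :: 'a))"
  have row: "(\<Sum>m\<in>{0..<k}. ?Y $$ (i, m) * ?U $$ (m, j)) = (if i \<le> j then a else b)"
    if "i < k" "j < k" for i j
  proof -
    have "(\<Sum>m\<in>{0..<k}. ?Y $$ (i, m) * ?U $$ (m, j))
        = (\<Sum>m\<in>{0..<k}. (if m = 0 then if i = 0 then a else b else 0) + (if m = i then if 0 < i \<and> i \<le> j then a - b else 0 else 0))"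
      by (intro sum.cong) (use that in auto)
    also have "\<dots> = (if i \<le> j then a else b)"
      using that by (auto simp: sum.distrib)
    finally show ?thesis .
  qed
  have "Matrix.mat k k (\<lambda>(i, j). if i \<le> j then a else b) = ?Y * ?U"
  proof (rule eq_matI)
    fix i j assume "i < dim_row (?Y * ?U)" "j < dim_col (?Y * ?U)"
    then have ij: "i < k" "j < k" by auto
    have "(?Y * ?U) $$ (i, j) = (\<Sum>m\<in>{0..<k}. ?Y $$ (i, m) * ?U $$ (m, j))"
      using ij by (simp add: scalar_prod_def)
    then show "Matrix.mat k k (\<lambda>(i, j). if i \<le> j then a else b) $$ (i, j) = (?Y * ?U) $$ (i, j)"
      using row[OF ij] ij by simp
  qed auto
  also have "Determinant.det (?Y * ?U) = Determinant.det ?Y * Determinant.det ?U"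
    by (rule Determinant.det_mult) auto
  also have "Determinant.det ?Y = prod_list (diag_mat ?Y)"
    by (rule det_lower_triangular[of k]) auto
  also have "\<dots> = (\<Prod>i<k. if i = 0 then a else a - b)"
    by (auto simp: prod_list_diag_prod atLeast0LessThan intro!: prod.cong)
  also have "\<dots> = a * (a - b) ^ (k - 1)"
    using k by (cases k) (simp_all add: prod.lessThan_Suc_shift del: prod.lessThan_Suc)
  also have "Determinant.det ?U = prod_list (diag_mat ?U)"
    by (rule det_upper_triangular[of _ k]) auto
  also have "\<dots> = 1"
    by (simp add: prod_list_diag_prod)
  finally show ?thesis by simp
qed

text \<open>Row \<open>i\<close> starts with \<open>r i\<close> entries \<open>q\<close> followed by ones, so two equal values of \<open>r\<close> give equal rows. If
  \<open>r\<close> is strictly increasing from \<open>k\<close> indices into \<open>{0..k}\<close>, it omits exactly one value. When the omitted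
  value lies strictly between \<open>0\<close> and \<open>k\<close>, the first row consists of ones and the last row of entries
  \<open>q\<close>, and these are proportional. The two extreme omissions give the two triangular matrices.\<close>

lemma det_staircase:
  fixes q :: "'a :: idom"
  assumes k: "k > 0"
    and mono: "\<And>i i'. i \<le> i' \<Longrightarrow> i' < k \<Longrightarrow> r i \<le> r i'"
    and bound: "\<And>i. i < k \<Longrightarrow> r i \<le> k"
  shows "Determinant.det (Matrix.mat k k (\<lambda>(i, j). if j < r i then q else 1)) =
    (if \<forall>i<k. r i = i then (1 - q) ^ (k - 1)
     else if \<forall>i<k. r i = Suc i then q * (q - 1) ^ (k - 1) else 0)"
proof -
  let ?D = "Matrix.mat k k (\<lambda>(i, j). if j < r i then q else 1)"
  consider (diag) "\<forall>i<k. r i = i" | (shift) "\<forall>i<k. r i = Suc i"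
    | (none) "\<not> (\<forall>i<k. r i = i)" "\<not> (\<forall>i<k. r i = Suc i)" by blast
  then show ?thesis
  proof cases
    case diag
    then have "?D = Matrix.mat k k (\<lambda>(i, j). if i \<le> j then 1 else q)"
      by (intro eq_matI) auto
    then show ?thesis using diag k by (simp add: det_two_valued_triangular)
  next
    case shift
    let ?E = "Matrix.mat k k (\<lambda>(i, j). if i \<le> j then q else 1)"
    have "?D = ?E\<^sup>T" using shift by (intro eq_matI) auto
    then have "Determinant.det ?D = q * (q - 1) ^ (k - 1)"
      using k Determinant.det_transpose[of ?E k] by (simp add: det_two_valued_triangular)
    moreover have "\<not> (\<forall>i<k. r i = i)" using shift k by force
    ultimately show ?thesis by (simp only: if_False if_P[OF shift])
  next
    case none
    have "Determinant.det ?D = 0"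
    proof (rule ccontr)
      assume nz: "Determinant.det ?D \<noteq> 0"
      have ne: "r i \<noteq> r i'" if "i < i'" "i' < k" for i i'
      proof
        assume "r i = r i'"
        then have "Determinant.det ?D = 0"
          using that by (intro Determinant.det_identical_rows[of _ k i i']) (auto intro!: eq_vecI)
        then show False using nz by simp
      qed
      have step: "r i < r (Suc i)" if "Suc i < k" for i
        using ne[of i "Suc i"] mono[of i "Suc i"] that by simp
      \<comment> \<open>strictly increasing integers grow at least as fast as their index, seen from either end\<close>
      have low: "r 0 + i \<le> r i" if "i < k" for i
        using that by (induction i) (use step in \<open>fastforce+\<close>)
      have high: "r (k - 1 - i) + i \<le> r (k - 1)" if "i < k" for i
        using that
      proof (induction i)
        case (Suc i)
        have "Suc (k - 1 - Suc i) = k - 1 - i" using Suc.prems by simp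
        then show ?case using Suc step[of "k - 1 - Suc i"] by simp
      qed simp
      have high': "r i + (k - 1 - i) \<le> r (k - 1)" if "i < k" for i
        using high[of "k - 1 - i"] that by simp
      show False
      proof (cases "r 0 = 0 \<and> r (k - 1) = k")
        case True
        then have "k - 1 \<noteq> 0" using k by auto
        \<comment> \<open>the last row is \<open>q\<close> times the row of ones, which in \<open>?R\<close> occurs first and last\<close>
        let ?R = "Matrix.mat k k (\<lambda>(i, j). if i < k - 1 \<and> j < r i then q else 1)"
        have "?D = multrow (k - 1) q ?R"
          using True by (intro eq_matI) auto
        then have "Determinant.det ?D = q * Determinant.det ?R"
          using Determinant.det_multrow[of "k - 1" k ?R q] k by simp
        also have "Determinant.det ?R = 0"
          using True k \<open>k - 1 \<noteq> 0\<close>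
          by (intro Determinant.det_identical_rows[of _ k 0 "k - 1"]) (auto intro!: eq_vecI)
        finally show False using nz by simp
      next
        case False
        have "r (k - 1) \<le> k" using bound[of "k - 1"] k by simp
        show False
        proof (cases "r 0 = 0")
          case True
          with False \<open>r (k - 1) \<le> k\<close> have "r (k - 1) \<le> k - 1" by simp
          then have "r i = i" if "i < k" for i
            using low[OF that] high'[OF that] that True by linarith
          then show False using none by blast
        next
          case False
          then have "r i = Suc i" if "i < k" for i
            using low[OF that] high'[OF that] that \<open>r (k - 1) \<le> k\<close> by linarith
          then show False using none by blast
        qed
      qed
    qed
    then show ?thesis using none by auto
  qed
qed

text \<open>Here \<open>r i\<close> in the staircase counts the points of the second string to the left of the \<open>i\<close>-th point of
  the first; \<open>r i = i\<close> and \<open>r i = i + 1\<close> are precisely the two alternatives in the definition of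
  interlacing, and they are told apart by the two leftmost points.\<close>

lemma det_interlacing:
  fixes q :: "'a :: idom" and t t' :: "nat \<Rightarrow> real"
  assumes k: "k > 0"
    and inc: "\<And>j. j \<in> {1..<k} \<Longrightarrow> t j < t (j + 1)"
    and inc': "\<And>j. j \<in> {1..<k} \<Longrightarrow> t' j < t' (j + 1)"
  shows "Determinant.det (Matrix.mat k k (\<lambda>(i, j). if t' (Suc j) < t (Suc i) then q else 1)) =
    (if interlaced k t t' then (1 - q) ^ (k - 1) * (if t' 1 < t 1 then (- 1) ^ (k - 1) * q else 1) else 0)"
proof -
  define r where "r i = card {j. j < k \<and> t' (Suc j) < t (Suc i)}" for i
  have mono: "t (Suc i) \<le> t (Suc j)" if "i \<le> j" "j < k" for i j
    using that by (induction j rule: dec_induct) (use inc in \<open>fastforce+\<close>)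
  have mono': "t' (Suc i) \<le> t' (Suc j)" if "i \<le> j" "j < k" for i j
    using that by (induction j rule: dec_induct) (use inc' in \<open>fastforce+\<close>)
  have r: "t' (Suc j) < t (Suc i) \<longleftrightarrow> j < r i" if "j < k" for i j
  proof
    assume "t' (Suc j) < t (Suc i)"
    then have "{..j} \<subseteq> {j. j < k \<and> t' (Suc j) < t (Suc i)}"
      using mono' that by fastforce
    from card_mono[OF _ this] show "j < r i" by (simp add: r_def)
  next
    assume "j < r i"
    show "t' (Suc j) < t (Suc i)"
    proof (rule ccontr)
      assume "\<not> t' (Suc j) < t (Suc i)"
      then have "j' < j" if "j' < k" "t' (Suc j') < t (Suc i)" for j'
        using mono'[of j j'] that by linarith
      then have "{j. j < k \<and> t' (Suc j) < t (Suc i)} \<subseteq> {..<j}" by blast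
      from card_mono[OF _ this] show False using \<open>j < r i\<close> by (simp add: r_def)
    qed
  qed
  have rk: "r i \<le> k" for i
    unfolding r_def by (rule order_trans[OF card_mono[of "{..<k}"]]) auto
  have rmono: "r i \<le> r i'" if "i \<le> i'" "i' < k" for i i'
    unfolding r_def by (intro card_mono) (use mono[OF that] in auto)
  have r_eq: "r i = m \<longleftrightarrow> (m < k \<longrightarrow> t (Suc i) \<le> t' (Suc m)) \<and> (0 < m \<longrightarrow> t' m < t (Suc i))" if "m \<le> k" for i m
  proof -
    have "r i \<le> m \<longleftrightarrow> (m < k \<longrightarrow> t (Suc i) \<le> t' (Suc m))"
      using r[of m i] rk[of i] by (cases "m < k") (auto simp: not_less)
    moreover have "m \<le> r i \<longleftrightarrow> (0 < m \<longrightarrow> t' m < t (Suc i))"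
      using r[of "m - 1" i] that by (cases m) auto
    ultimately show ?thesis by auto
  qed
  have diag: "(\<forall>i<k. r i = i) \<longleftrightarrow> (\<forall>j\<in>{1..k}. t j \<le> t' j) \<and> (\<forall>j\<in>{1..<k}. t' j < t (j + 1))"
  proof -
    have "(\<forall>i<k. r i = i) \<longleftrightarrow> (\<forall>i<k. t (Suc i) \<le> t' (Suc i)) \<and> (\<forall>i<k. 0 < i \<longrightarrow> t' i < t (Suc i))"
      using r_eq by auto
    also have "(\<forall>i<k. t (Suc i) \<le> t' (Suc i)) \<longleftrightarrow> (\<forall>j\<in>{1..k}. t j \<le> t' j)"
      by (metis One_nat_def Suc_le_eq atLeastAtMost_iff not0_implies_Suc not_one_le_zero zero_less_Suc)
    finally show ?thesis by auto
  qed
  have shift: "(\<forall>i<k. r i = Suc i) \<longleftrightarrow> (\<forall>j\<in>{1..k}. t' j < t j) \<and> (\<forall>j\<in>{1..<k}. t j \<le> t' (j + 1))"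
  proof -
    have "(\<forall>i<k. r i = Suc i) \<longleftrightarrow> (\<forall>i<k. t' (Suc i) < t (Suc i)) \<and> (\<forall>i<k. Suc i < k \<longrightarrow> t (Suc i) \<le> t' (Suc (Suc i)))"
      using r_eq by auto
    also have "(\<forall>i<k. t' (Suc i) < t (Suc i)) \<longleftrightarrow> (\<forall>j\<in>{1..k}. t' j < t j)"
      by (metis One_nat_def Suc_le_eq atLeastAtMost_iff not0_implies_Suc not_one_le_zero zero_less_Suc)
    also have "(\<forall>i<k. Suc i < k \<longrightarrow> t (Suc i) \<le> t' (Suc (Suc i))) \<longleftrightarrow> (\<forall>j\<in>{1..<k}. t j \<le> t' (j + 1))"
      by (metis One_nat_def Suc_eq_plus1 Suc_le_eq Suc_lessD atLeastLessThan_iff not0_implies_Suc not_one_le_zero zero_less_Suc)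
    finally show ?thesis .
  qed
  have first: "\<forall>i<k. r i = i \<Longrightarrow> \<not> t' 1 < t 1" "\<forall>i<k. r i = Suc i \<Longrightarrow> t' 1 < t 1"
    using r[of 0 0] k by auto
  have "Matrix.mat k k (\<lambda>(i, j). if t' (Suc j) < t (Suc i) then q else 1)
      = Matrix.mat k k (\<lambda>(i, j). if j < r i then q else 1)"
    using r by (intro eq_matI) auto
  then have "Determinant.det (Matrix.mat k k (\<lambda>(i, j). if t' (Suc j) < t (Suc i) then q else 1)) =
    (if \<forall>i<k. r i = i then (1 - q) ^ (k - 1)
     else if \<forall>i<k. r i = Suc i then q * (q - 1) ^ (k - 1) else 0)"
    using det_staircase[of k r q, OF k rmono rk] by simp
  moreover have "(q - 1) ^ (k - 1) = (- 1) ^ (k - 1) * (1 - q) ^ (k - 1)"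
    by (simp flip: power_mult_distrib)
  moreover have "interlaced k t t' \<longleftrightarrow> (\<forall>i<k. r i = i) \<or> (\<forall>i<k. r i = Suc i)"
    unfolding interlaced_def diag shift ..
  moreover have "(if A then u else if S then q * v else 0) = (if A \<or> S then u * (if c then e * q else 1) else 0)"
    if "A \<Longrightarrow> \<not> c" "S \<Longrightarrow> c" "v = e * u" for A S c and u v e :: 'a
    using that by (auto simp: mult_ac)
  ultimately show ?thesis using first by presburger
qed

section \<open>The determinant of points sorted by string\<close>

lemma bij_betw_next_string:
  fixes n :: nat
  assumes "n > 0"
  shows "bij_betw (\<lambda>h. (h + 1) mod n) {..<n} {..<n}"
proof (rule bij_betw_byWitness[where f' = "\<lambda>h. (h + n - 1) mod n"])
  show "\<forall>h\<in>{..<n}. ((h + 1) mod n + n - 1) mod n = h"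
  proof
    fix h assume "h \<in> {..<n}"
    then show "((h + 1) mod n + n - 1) mod n = h"
      by (cases "Suc h = n") auto
  qed
  show "\<forall>h\<in>{..<n}. ((h + n - 1) mod n + 1) mod n = h"
  proof
    fix h assume "h \<in> {..<n}"
    then show "((h + n - 1) mod n + 1) mod n = h"
      by (cases h) (auto simp: mod_Suc)
  qed
qed (use assms in auto)

text \<open>With the points sorted by string, the matrix is block cyclic: rows of string \<open>h\<close> meet columns of
  string \<open>h + 1\<close>. Moving the first \<open>k\<close> columns to the end makes it block diagonal at the price of the
  sign \<open>(-1) ^ ((n - 1) * k * k)\<close>, which equals \<open>(-1) ^ ((n + 1) * k)\<close>. Each of the \<open>n\<close> blocks then tests whether
  two neighbouring strings interlace, and the blocks with the factor \<open>(-1) ^ (k - 1) * q\<close> are those counted by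
  the occupation number.\<close>

lemma kernel_det_step_kernel_sliced:
  assumes n: "n > 0" and k: "k > 0"
    and slice: "\<And>i. i < n * k \<Longrightarrow> snd (y i) = i div k"
    and x: "\<And>h j. h < n \<Longrightarrow> j < k \<Longrightarrow> x h (Suc j) = fst (y (h * k + j))"
    and inc: "\<And>h j. h < n \<Longrightarrow> j \<in> {1..<k} \<Longrightarrow> x h j < x h (j + 1)"
  shows "kernel_det (step_kernel n q) (n * k) y = (- 1) ^ ((n + 1) * k) * (1 - q) ^ (n * (k - 1)) *
    (if \<forall>h<n. interlaced k (x h) (x ((h + 1) mod n))
     then ((- 1) ^ (k - 1) * q) ^ card {h. h < n \<and> x h 1 < x ((h + n - 1) mod n) 1} else 0)"
proof -
  let ?A = "Matrix.mat (n * k) (n * k) (\<lambda>(i, j). step_kernel n q (y i) (y j))"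
  \<comment> \<open>the number of columns that the first \<open>k\<close> columns have to pass\<close>
  define m where "m = (n - 1) * k"
  have N: "n * k = m + k" using n by (cases n) (auto simp: m_def)
  define f where "f h i j = (if x ((h + 1) mod n) (Suc j) < x h (Suc i) then q else 1)" for h i j
  have lt: "i div k < n \<longleftrightarrow> i < n * k" for i
    using k by (simp add: div_less_iff_less_mult)
  have y: "y i = (x (i div k) (Suc (i mod k)), i div k)" if "i < n * k" for i
    using slice[OF that] x[of "i div k" "i mod k"] that lt[of i] k by (auto simp: prod_eq_iff)
  \<comment> \<open>the shift of columns by \<open>k\<close> modulo \<open>n * k\<close> sends block \<open>h\<close> to block \<open>h + 1\<close> modulo \<open>n\<close>\<close>
  have block: "?A $$ (i, if j < m then j + k else j - m) =
      (if i div k = j div k then f (i div k) (i mod k) (j mod k) else 0)"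
    if ij: "i < n * k" "j < n * k" for i j
  proof -
    define j' where "j' = (if j < m then j + k else j - m)"
    have j': "j' < n * k" "j' mod k = j mod k" "j' div k = (j div k + 1) mod n"
    proof -
      show "j' < n * k" using ij by (auto simp: j'_def N)
      have jm: "j mod k = (j - m) mod k" "j div k = (n - 1) + (j - m) div k" if "\<not> j < m"
      proof -
        define s where "s = j - m"
        then have s: "j = m + s" using that by simp
        show "j mod k = (j - m) mod k" "j div k = (n - 1) + (j - m) div k"
          using k by (simp_all add: s m_def)
      qed
      show "j' mod k = j mod k" using jm by (auto simp: j'_def)
      show "j' div k = (j div k + 1) mod n"
      proof (cases "j < m")
        case True
        then have "j div k < n - 1" using k by (simp add: m_def div_less_iff_less_mult)
        then show ?thesis using True k by (simp add: j'_def)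
      next
        case False
        then have "j - m < k" using ij by (simp add: N)
        then show ?thesis using False jm(2) n by (simp add: j'_def)
      qed
    qed
    have "i div k < n" "j div k < n" using ij lt by auto
    then have inj: "i div k = j div k" if "(j div k + 1) mod n = (i div k + 1) mod n"
      using inj_onD[OF bij_betw_imp_inj_on[OF bij_betw_next_string[OF n]] that] by simp
    have "?A $$ (i, j') = step_kernel n q (y i) (y j')"
      using ij(1) j'(1) by simp
    also have "\<dots> = (if i div k = j div k then f (i div k) (i mod k) (j mod k) else 0)"
      unfolding y[OF ij(1)] y[OF j'(1)] j'(2,3) step_kernel_def f_def using inj by (auto simp del: mod_Suc_eq)
    finally show ?thesis by (simp only: j'_def)
  qed
  have sgn: "(- 1) ^ (m * k) = ((- 1) ^ ((n + 1) * k) :: complex)"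
    using n by (cases n) (auto simp: m_def minus_one_power_iff)
  have "kernel_det (step_kernel n q) (n * k) y = (- 1) ^ (m * k) *
    Determinant.det (Matrix.mat (n * k) (n * k) (\<lambda>(i, j). ?A $$ (i, if j < m then j + k else j - m)))"
    unfolding kernel_det_def N by (rule det_swap_cols) simp
  also have "Matrix.mat (n * k) (n * k) (\<lambda>(i, j). ?A $$ (i, if j < m then j + k else j - m)) =
    Matrix.mat (n * k) (n * k) (\<lambda>(i, j). if i div k = j div k then f (i div k) (i mod k) (j mod k) else 0)"
    using block by (intro eq_matI) auto
  also have "Determinant.det \<dots> = (\<Prod>h<n. Determinant.det (Matrix.mat k k (\<lambda>(i, j). f h i j)))"
    by (rule det_block_diagonal[OF k])
  also have "\<dots> = (\<Prod>h<n. if interlaced k (x h) (x ((h + 1) mod n))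
      then (1 - q) ^ (k - 1) * (if x ((h + 1) mod n) 1 < x h 1 then (- 1) ^ (k - 1) * q else 1) else 0)"
    unfolding f_def by (intro prod.cong refl det_interlacing k inc) (use n in auto)
  also have "\<dots> = (if \<forall>h<n. interlaced k (x h) (x ((h + 1) mod n))
     then (1 - q) ^ (n * (k - 1)) * (\<Prod>h<n. if x ((h + 1) mod n) 1 < x h 1 then (- 1) ^ (k - 1) * q else 1) else 0)"
    by (auto simp: prod.distrib power_mult[symmetric] mult.commute intro!: prod_zero)
  also have "(\<Prod>h<n. if x ((h + 1) mod n) 1 < x h 1 then (- 1) ^ (k - 1) * q else 1)
      = (\<Prod>h<n. if x h 1 < x ((h + n - 1) mod n) 1 then (- 1) ^ (k - 1) * q else 1)"
    (is "_ = (\<Prod>h<n. ?g h)")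
  proof -
    have "(\<Prod>h<n. if x ((h + 1) mod n) 1 < x h 1 then (- 1) ^ (k - 1) * q else 1) = (\<Prod>h<n. ?g ((h + 1) mod n))"
    proof (rule prod.cong[OF refl])
      fix h assume "h \<in> {..<n}"
      then have "((h + 1) mod n + n - 1) mod n = h" by (cases "Suc h = n") auto
      then show "(if x ((h + 1) mod n) 1 < x h 1 then (- 1) ^ (k - 1) * q else 1) = ?g ((h + 1) mod n)"
        by (simp only:)
    qed
    also have "\<dots> = (\<Prod>h<n. ?g h)"
      by (rule prod.reindex_bij_betw[OF bij_betw_next_string[OF n]])
    finally show ?thesis .
  qed
  also have "(\<Prod>h<n. if P h then c else 1) = c ^ card {h. h < n \<and> P h}" for P and c :: complex
    using prod.inter_filter[of "{..<n}" "\<lambda>_. c" P] by simp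
  finally show ?thesis unfolding sgn by (auto simp: mult.assoc)
qed

section \<open>Sorting points and counting them on strings\<close>

lemma ex1_sorting_permutation:
  fixes a :: "nat \<Rightarrow> 'a :: linorder"
  assumes inj: "inj_on a {..<N}"
  shows "\<exists>!p. p permutes {..<N} \<and> strict_mono_on {..<N} (\<lambda>i. a (p i))"
proof -
  define L where "L = sorted_list_of_set (a ` {..<N})"
  have len: "length L = N" using inj by (simp add: L_def card_image)
  have setL: "set L = a ` {..<N}" and dist: "distinct L" and srt: "sorted_wrt (<) L"
    by (simp_all add: L_def)
  have L_eq: "a (p i) = L ! i"
    if p: "p permutes {..<N}" and mono: "strict_mono_on {..<N} (\<lambda>i. a (p i))" and "i < N" for p i
  proof -
    have "sorted_wrt (<) (map (\<lambda>i. a (p i)) [0..<N])"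
      using mono by (auto simp: sorted_wrt_iff_nth_less strict_mono_on_def)
    moreover have "set (map (\<lambda>i. a (p i)) [0..<N]) = a ` {..<N}"
      using permutes_image[OF p] by (auto simp: atLeast0LessThan image_image[symmetric, of a p])
    ultimately have "map (\<lambda>i. a (p i)) [0..<N] = L"
      using srt setL by (metis strict_sorted_equal)
    then show ?thesis using \<open>i < N\<close> by (metis add_0 nth_map_upt diff_zero)
  qed
  show ?thesis
  proof (rule ex_ex1I)
    define p where "p i = (if i < N then the_inv_into {..<N} a (L ! i) else i)" for i
    have ap: "a (p i) = L ! i" and pN: "p i < N" if "i < N" for i
    proof -
      have "L ! i \<in> a ` {..<N}" using that len setL nth_mem by metis
      then show "a (p i) = L ! i" "p i < N"
        using that inj f_the_inv_into_f[OF inj] the_inv_into_into[OF inj, of "L ! i" "{..<N}"]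
        by (auto simp: p_def)
    qed
    have "inj_on p {..<N}"
    proof (rule inj_onI)
      fix i j assume ij: "i \<in> {..<N}" "j \<in> {..<N}" "p i = p j"
      have "L ! i = a (p i)" using ap[of i] ij(1) by simp
      also have "\<dots> = L ! j" unfolding ij(3) using ap[of j] ij(2) by simp
      finally show "i = j" using nth_eq_iff_index_eq[OF dist] ij(1,2) len by simp
    qed
    moreover from this have "p ` {..<N} = {..<N}"
      by (intro endo_inj_surj) (auto simp: pN)
    ultimately have "bij_betw p {..<N} {..<N}"
      unfolding bij_betw_def by blast
    then have "p permutes {..<N}" by (rule bij_imp_permutes) (simp add: p_def)
    moreover have "strict_mono_on {..<N} (\<lambda>i. a (p i))"
      using srt len by (auto simp: strict_mono_on_def ap sorted_wrt_iff_nth_less)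
    ultimately show "\<exists>p. p permutes {..<N} \<and> strict_mono_on {..<N} (\<lambda>i. a (p i))" by blast
  next
    fix p p'
    assume p: "p permutes {..<N} \<and> strict_mono_on {..<N} (\<lambda>i. a (p i))"
      and p': "p' permutes {..<N} \<and> strict_mono_on {..<N} (\<lambda>i. a (p' i))"
    show "p = p'"
    proof
      fix i
      show "p i = p' i"
      proof (cases "i < N")
        case True
        then have "a (p i) = a (p' i)" using L_eq p p' by metis
        moreover have "p i < N" "p' i < N"
          using True p p' permutes_in_image[of _ "{..<N}" i] by auto
        ultimately show ?thesis using inj by (auto dest: inj_onD)
      next
        case False
        then have "p i = i" "p' i = i"
          using permutes_not_in[of p "{..<N}" i] permutes_not_in[of p' "{..<N}" i] p p' by auto
        then show ?thesis by simp
      qed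
    qed
  qed
qed

text \<open>A permutation that contributes to the determinant maps the points of each string injectively to
  points of the next one; going once around the cylinder, all strings carry equally many points.\<close>

lemma kernel_det_step_kernel_nonzero:
  assumes nz: "kernel_det (step_kernel n q) N y \<noteq> 0"
    and n: "n > 0" and s: "\<And>i. i < N \<Longrightarrow> snd (y i) < n"
  obtains k where "N = n * k" "\<And>h. h < n \<Longrightarrow> card {i. i < N \<and> snd (y i) = h} = k"
proof -
  define c where "c h = card {i. i < N \<and> snd (y i) = h}" for h
  obtain p where p: "p permutes {..<N}" and nzp: "(\<Prod>i<N. step_kernel n q (y i) (y (p i))) \<noteq> 0"
    using nz unfolding kernel_det_expand by (metis (mono_tags, lifting) mem_Collect_eq mult_zero_right sum.neutral)
  have next_string: "snd (y (p i)) = (snd (y i) + 1) mod n" if "i < N" for i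
  proof -
    have "step_kernel n q (y i) (y (p i)) \<noteq> 0" using nzp that by auto
    then show ?thesis by (auto simp: step_kernel_def split: prod.splits if_splits)
  qed
  have c_next: "c ((h + 1) mod n) = c h" if "h < n" for h
  proof -
    have "bij_betw p {i. i < N \<and> snd (y i) = h} {i. i < N \<and> snd (y i) = (h + 1) mod n}"
    proof (rule bij_betw_imageI)
      show "inj_on p {i. i < N \<and> snd (y i) = h}" using permutes_inj[OF p] by (rule inj_on_subset) simp
      show "p ` {i. i < N \<and> snd (y i) = h} = {i. i < N \<and> snd (y i) = (h + 1) mod n}"
      proof (intro equalityI subsetI)
        fix i assume i: "i \<in> {i. i < N \<and> snd (y i) = (h + 1) mod n}"
        then obtain j where j: "i = p j" "j < N"
          using permutes_image[OF p] by blast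
        then have eq: "(snd (y j) + 1) mod n = (h + 1) mod n" using next_string i by simp
        have "snd (y j) = h"
          using inj_onD[OF bij_betw_imp_inj_on[OF bij_betw_next_string[OF n]] eq] s[OF j(2)] that by simp
        then show "i \<in> p ` {i. i < N \<and> snd (y i) = h}" using j by blast
      qed (use next_string permutes_in_image[OF p] in auto)
    qed
    then show ?thesis unfolding c_def by (rule bij_betw_same_card[symmetric])
  qed
  have c: "c h = c 0" if "h < n" for h
    using that
  proof (induction h)
    case (Suc h)
    then show ?case using c_next[of h] by simp
  qed simp
  have "{..<N} = (\<Union>h<n. {i. i < N \<and> snd (y i) = h})" using s by auto
  then have "N = card (\<Union>h<n. {i. i < N \<and> snd (y i) = h})" by (metis card_lessThan)
  also have "\<dots> = (\<Sum>h<n. c h)" unfolding c_def by (rule card_UN_disjoint) auto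
  also have "\<dots> = (\<Sum>h<n. c 0)" by (rule sum.cong[OF refl], rule c) simp
  finally have "N = n * c 0" by simp
  moreover have "card {i. i < N \<and> snd (y i) = h} = c 0" if "h < n" for h
    using c[OF that] by (simp only: c_def)
  ultimately show ?thesis by (rule that)
qed

text \<open>A monotone enumeration of \<open>n\<close> classes of size \<open>k\<close> lists them in consecutive blocks: the elements below
  class \<open>s i\<close> number \<open>s i * k\<close> and all come before \<open>i\<close>.\<close>

lemma equal_fibres_imp_div:
  fixes s :: "nat \<Rightarrow> nat"
  assumes mono: "\<And>i j. i \<le> j \<Longrightarrow> j < n * k \<Longrightarrow> s i \<le> s j"
    and s: "\<And>i. i < n * k \<Longrightarrow> s i < n"
    and fibre: "\<And>h. h < n \<Longrightarrow> card {i. i < n * k \<and> s i = h} = k"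
    and i: "i < n * k"
  shows "s i = i div k"
proof -
  have below: "card {j. j < n * k \<and> s j < m} = m * k" if "m \<le> n" for m
    using that
  proof (induction m)
    case (Suc m)
    have "{j. j < n * k \<and> s j < Suc m} = {j. j < n * k \<and> s j < m} \<union> {j. j < n * k \<and> s j = m}"
      by auto
    then have "card {j. j < n * k \<and> s j < Suc m} =
        card {j. j < n * k \<and> s j < m} + card {j. j < n * k \<and> s j = m}"
      by (simp add: card_Un_disjoint disjoint_iff)
    then show ?case using Suc fibre[of m] by simp
  qed simp
  have "{j. j < n * k \<and> s j < s i} \<subseteq> {..<i}"
    using mono[of i] by (force simp: not_less[symmetric])
  from card_mono[OF _ this] have lo: "s i * k \<le> i" using below[of "s i"] s[OF i] by simp
  have "{..i} \<subseteq> {j. j < n * k \<and> s j < Suc (s i)}"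
    using mono[of _ i] i by (auto simp: less_Suc_eq_le)
  from card_mono[OF _ this] have hi: "i < Suc (s i) * k" using below[of "Suc (s i)"] s[OF i] by simp
  show ?thesis
    using lo hi by (metis div_nat_eqI mult.commute)
qed

section \<open>Products of the torus measure and their slices\<close>

lemma distr_PiM_permute:
  fixes I :: "'i set"
  assumes M: "sigma_finite_measure M" and I: "finite I" and p: "p permutes I"
  shows "(\<lambda>y i. y (p i)) \<in> measurable (PiM I (\<lambda>_. M)) (PiM I (\<lambda>_. M))"
    and "distr (PiM I (\<lambda>_. M)) (PiM I (\<lambda>_. M)) (\<lambda>y i. y (p i)) = PiM I (\<lambda>_. M)"
proof -
  interpret product_sigma_finite "\<lambda>_. M" by (rule product_sigma_finite.intro) (rule M)
  let ?P = "PiM I (\<lambda>_. M)"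
  have pI: "p i \<in> I \<longleftrightarrow> i \<in> I" for i using permutes_in_image[OF p] .
  show meas: "(\<lambda>y i. y (p i)) \<in> measurable ?P ?P"
  proof (rule measurable_PiM_single')
    show "(\<lambda>y. y (p i)) \<in> measurable ?P M" if "i \<in> I" for i
      by (rule measurable_component_singleton) (use that pI in simp)
    show "(\<lambda>y i. y (p i)) \<in> space ?P \<rightarrow> (\<Pi>\<^sub>E i\<in>I. space M)"
      using pI by (auto simp: space_PiM PiE_iff extensional_def)
  qed
  show "distr ?P ?P (\<lambda>y i. y (p i)) = ?P"
  proof (rule PiM_eqI[OF I])
    fix A assume A: "\<And>i. i \<in> I \<Longrightarrow> A i \<in> sets M"
    have q: "inv_into UNIV p i \<in> I \<longleftrightarrow> i \<in> I" for i using permutes_in_image[OF permutes_inv[OF p]] .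
    have "(\<lambda>y i. y (p i)) -` Pi\<^sub>E I A \<inter> space ?P = Pi\<^sub>E I (\<lambda>i. A (inv_into UNIV p i))"
    proof (intro equalityI subsetI)
      fix y assume y: "y \<in> (\<lambda>y i. y (p i)) -` Pi\<^sub>E I A \<inter> space ?P"
      have "y i \<in> A (inv_into UNIV p i)" if "i \<in> I" for i
      proof -
        have "y (p (inv_into UNIV p i)) \<in> A (inv_into UNIV p i)" using y q that by (auto simp: PiE_iff)
        then show ?thesis by (simp add: permutes_inverses(1)[OF p])
      qed
      then show "y \<in> Pi\<^sub>E I (\<lambda>i. A (inv_into UNIV p i))" using y by (auto simp: space_PiM PiE_iff)
    next
      fix y assume y: "y \<in> Pi\<^sub>E I (\<lambda>i. A (inv_into UNIV p i))"
      have "y (p i) \<in> A i" if "i \<in> I" for i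
      proof -
        have "y (p i) \<in> A (inv_into UNIV p (p i))" using y pI that by (auto simp: PiE_iff)
        then show ?thesis by (simp add: permutes_inverses(2)[OF p])
      qed
      moreover have "y \<in> space ?P" using y q sets.sets_into_space[OF A]
        by (fastforce simp: space_PiM PiE_iff)
      ultimately show "y \<in> (\<lambda>y i. y (p i)) -` Pi\<^sub>E I A \<inter> space ?P"
        using y pI by (auto simp: PiE_iff extensional_def)
    qed
    then have "emeasure (distr ?P ?P (\<lambda>y i. y (p i))) (Pi\<^sub>E I A) = emeasure ?P (Pi\<^sub>E I (\<lambda>i. A (inv_into UNIV p i)))"
      using A I by (subst emeasure_distr[OF meas]) (auto intro!: sets_PiM_I_finite)
    also have "\<dots> = (\<Prod>i\<in>I. emeasure M (A (inv_into UNIV p i)))"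
      using A q I by (intro emeasure_PiM) auto
    also have "\<dots> = (\<Prod>i\<in>I. emeasure M (A i))"
      using prod.permute[OF permutes_inv[OF p], of "\<lambda>i. emeasure M (A i)"] by (simp add: o_def)
    finally show "emeasure (distr ?P ?P (\<lambda>y i. y (p i))) (Pi\<^sub>E I A) = (\<Prod>i\<in>I. emeasure M (A i))" .
  qed simp
qed

lemma finite_measure_torus_measure: "finite_measure (torus_measure n)"
  and space_torus_measure: "space (torus_measure n) = {0..<1} \<times> {..<n}"
  and measure_torus_measure: "measure (torus_measure n) (space (torus_measure n)) = real n"
  and emeasure_torus_measure_string: "A \<in> sets lborel \<Longrightarrow> h < n \<Longrightarrow>
    emeasure (torus_measure n) ((A \<inter> {0..<1}) \<times> {h}) = emeasure lborel (A \<inter> {0..<1})"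
  and sets_torus_measure_string: "A \<in> sets lborel \<Longrightarrow> h < n \<Longrightarrow>
    (A \<inter> {0..<1}) \<times> {h} \<in> sets (torus_measure n)"
proof -
  let ?U = "restrict_space lborel {0..<1} :: real measure" and ?C = "count_space {..<n}"
  interpret C: sigma_finite_measure ?C
    by (rule sigma_finite_measure_count_space_finite) simp
  have sU: "A \<inter> {0..<1} \<in> sets ?U" if "A \<in> sets lborel" for A
    using that by (auto simp: sets_restrict_space)
  have times: "emeasure (torus_measure n) ((A \<inter> {0..<1}) \<times> B) = emeasure lborel (A \<inter> {0..<1}) * of_nat (card B)"
    if "A \<in> sets lborel" "B \<subseteq> {..<n}" for A B
  proof -
    have "finite B" using that(2) finite_subset by auto
    then show ?thesis
      unfolding torus_measure_def using that sU[OF that(1)]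
      by (subst C.emeasure_pair_measure_Times) (auto simp: emeasure_restrict_space)
  qed
  show sp: "space (torus_measure n) = {0..<1} \<times> {..<n}"
    by (auto simp: torus_measure_def space_pair_measure space_restrict_space)
  have tot: "emeasure (torus_measure n) (space (torus_measure n)) = of_nat n"
    using times[of UNIV "{..<n}"] unfolding sp by simp
  show "finite_measure (torus_measure n)"
    by (rule finite_measureI) (simp add: tot)
  show "measure (torus_measure n) (space (torus_measure n)) = real n"
    unfolding measure_def tot by simp
  show "emeasure (torus_measure n) ((A \<inter> {0..<1}) \<times> {h}) = emeasure lborel (A \<inter> {0..<1})"
    if "A \<in> sets lborel" "h < n"
    using times[of A "{h}"] that by simp
  show "(A \<inter> {0..<1}) \<times> {h} \<in> sets (torus_measure n)" if "A \<in> sets lborel" "h < n"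
    unfolding torus_measure_def using sU[OF that(1)] that(2) by (intro pair_measureI) auto
qed

lemma finite_measure_PiM:
  assumes "finite_measure M" "finite I"
  shows "finite_measure (PiM I (\<lambda>_. M))"
    and "measure (PiM I (\<lambda>_. M)) (space (PiM I (\<lambda>_. M))) = measure M (space M) ^ card I"
proof -
  interpret finite_measure M by fact
  interpret product_sigma_finite "\<lambda>_. M" by (rule product_sigma_finite.intro) unfold_locales
  have "emeasure (PiM I (\<lambda>_. M)) (space (PiM I (\<lambda>_. M))) = emeasure M (space M) ^ card I"
    unfolding space_PiM using assms(2) by (subst emeasure_PiM) auto
  then have *: "emeasure (PiM I (\<lambda>_. M)) (space (PiM I (\<lambda>_. M))) = ennreal (measure M (space M) ^ card I)"
    by (simp add: emeasure_eq_measure ennreal_power)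
  show "finite_measure (PiM I (\<lambda>_. M))" by (rule finite_measureI) (simp add: *)
  show "measure (PiM I (\<lambda>_. M)) (space (PiM I (\<lambda>_. M))) = measure M (space M) ^ card I"
    unfolding measure_def[of "PiM I (\<lambda>_. M)"] * by simp
qed

text \<open>A tuple of \<open>n * k\<close> points that lists \<open>k\<close> points of string \<open>0\<close>, then \<open>k\<close> points of string \<open>1\<close>, and so on, is read
  as an array as in \<^const>\<open>bead_array\<close>; tuple indices start at \<open>0\<close>, bead indices at \<open>1\<close>.\<close>

definition string_array :: "nat \<Rightarrow> nat \<Rightarrow> (nat \<Rightarrow> real \<times> nat) \<Rightarrow> nat \<times> nat \<Rightarrow> real" where
  "string_array n k y = (\<lambda>(h, j)\<in>{..<n} \<times> {1..k}. fst (y (h * k + j - 1)))"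

definition slice :: "nat \<Rightarrow> nat \<Rightarrow> (nat \<Rightarrow> real \<times> nat) set" where
  "slice n k = {y \<in> space (PiM {..<n * k} (\<lambda>_. torus_measure n)). \<forall>i<n * k. snd (y i) = i div k}"

lemma measurable_fst_torus_measure [measurable]: "fst \<in> borel_measurable (torus_measure n)"
proof -
  have "fst \<in> measurable (torus_measure n) (restrict_space lborel {0..<1})"
    unfolding torus_measure_def by (rule measurable_fst)
  moreover have "(\<lambda>x. x) \<in> measurable (restrict_space lborel {0..<1}) (borel :: real measure)"
    by (rule measurable_restrict_space1) simp
  ultimately show ?thesis using measurable_compose by blast
qed

lemma measurable_snd_torus_measure [measurable]: "snd \<in> measurable (torus_measure n) (count_space UNIV)"
proof -
  have "snd \<in> measurable (torus_measure n) (count_space {..<n})"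
    unfolding torus_measure_def by (rule measurable_snd)
  moreover have "(\<lambda>x. x) \<in> measurable (count_space {..<n}) (count_space UNIV)"
    by simp
  ultimately show ?thesis using measurable_compose by blast
qed

lemma slice_sets: "slice n k \<in> sets (PiM {..<n * k} (\<lambda>_. torus_measure n))"
proof -
  let ?P = "PiM {..<n * k} (\<lambda>_. torus_measure n)"
  have "Measurable.pred ?P (\<lambda>y. \<forall>i\<in>{..<n * k}. snd (y i) = i div k)"
    by measurable
  then show ?thesis by (simp add: slice_def pred_def)
qed

text \<open>Fixing all string labels identifies a slice of the product of tori with a cube, measure included.
  Both the image of the restricted torus measure and Lebesgue measure restricted to the cube are the
  product of the uniform measures on \<open>[0, 1)\<close>, as they agree on boxes.\<close>

lemma emeasure_slice_string_array:
  assumes k: "k > 0" and B: "B \<in> sets (PiM ({..<n} \<times> {1..k}) (\<lambda>_. lborel))"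
    and cube: "B \<subseteq> Pi\<^sub>E ({..<n} \<times> {1..k}) (\<lambda>_. {0..<1})"
  shows "{y \<in> slice n k. string_array n k y \<in> B} \<in> sets (PiM {..<n * k} (\<lambda>_. torus_measure n))"
    and "emeasure (PiM {..<n * k} (\<lambda>_. torus_measure n)) {y \<in> slice n k. string_array n k y \<in> B} =
      emeasure (PiM ({..<n} \<times> {1..k}) (\<lambda>_. lborel)) B"
proof -
  let ?P = "PiM {..<n * k} (\<lambda>_. torus_measure n)"
  define J where "J = {..<n} \<times> {1..k}"
  let ?L = "PiM J (\<lambda>_. lborel :: real measure)"
  let ?U = "density lborel (indicator {0..<1 :: real})"
  let ?C = "Pi\<^sub>E J (\<lambda>_. {0..<1 :: real})"
  interpret T: product_sigma_finite "\<lambda>_. torus_measure n"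
    by (rule product_sigma_finite.intro) (rule finite_measure.axioms(1)[OF finite_measure_torus_measure])
  interpret Lb: product_sigma_finite "\<lambda>_. lborel :: real measure" by standard
  have U: "emeasure ?U A = emeasure lborel (A \<inter> {0..<1})" if "A \<in> sets lborel" for A
    using that by (subst emeasure_restricted) (auto simp: Int_commute)
  have finU: "finite_measure ?U"
    by (rule finite_measureI) (simp add: U)
  interpret Ub: product_sigma_finite "\<lambda>_. ?U"
    by (rule product_sigma_finite.intro) (rule finite_measure.axioms(1)[OF finU])
  have [simp]: "finite J" by (simp add: J_def)
  have lt: "i div k < n \<longleftrightarrow> i < n * k" for i
    using k by (simp add: div_less_iff_less_mult)
  have inverse: "(h * k + j - 1) div k = h" "Suc ((h * k + j - 1) mod k) = j" if j: "j \<in> {1..k}" for h j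
  proof -
    obtain j' where j': "j = Suc j'" "j' < k" using j by (cases j) auto
    then have eq: "h * k + j - 1 = h * k + j'" by simp
    show "(h * k + j - 1) div k = h" "Suc ((h * k + j - 1) mod k) = j"
      unfolding eq using j' by simp_all
  qed
  have arr_in: "h * k + j - 1 < n * k" if "h < n" "j \<in> {1..k}" for h j
    using inverse(1)[OF that(2), of h] lt that(1) by metis
  have bij: "bij_betw (\<lambda>i. (i div k, Suc (i mod k))) {..<n * k} J"
  proof (rule bij_betw_byWitness[where f' = "\<lambda>(h, j). h * k + j - 1"])
    show "\<forall>i\<in>{..<n * k}. (case (i div k, Suc (i mod k)) of (h, j) \<Rightarrow> h * k + j - 1) = i"
      by simp
    show "(\<lambda>i. (i div k, Suc (i mod k))) ` {..<n * k} \<subseteq> J"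
    proof (rule image_subsetI)
      fix i assume "i \<in> {..<n * k}"
      then have "i div k < n" "i mod k < k" using lt k by simp_all
      then show "(i div k, Suc (i mod k)) \<in> J" by (simp add: J_def)
    qed
    show "\<forall>p\<in>J. ((case p of (h, j) \<Rightarrow> h * k + j - 1) div k, Suc ((case p of (h, j) \<Rightarrow> h * k + j - 1) mod k)) = p"
      using inverse by (simp add: J_def split_beta)
    show "(\<lambda>(h, j). h * k + j - 1) ` J \<subseteq> {..<n * k}"
      using arr_in by (auto simp: J_def simp del: One_nat_def)
  qed
  have arr: "string_array n k \<in> measurable ?P ?L"
  proof (rule measurable_PiM_single')
    show "(\<lambda>y. string_array n k y p) \<in> measurable ?P lborel" if pJ: "p \<in> J" for p
    proof -
      obtain h j where p: "p = (h, j)" "h < n" "j \<in> {1..k}" using pJ by (auto simp: J_def)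
      have "(\<lambda>y. y (h * k + j - 1)) \<in> measurable ?P (torus_measure n)"
        by (rule measurable_component_singleton) (use arr_in p in auto)
      then have "(\<lambda>y. fst (y (h * k + j - 1))) \<in> borel_measurable ?P"
        by (rule measurable_compose) measurable
      then show ?thesis using p by (simp add: string_array_def)
    qed
    show "string_array n k \<in> space ?P \<rightarrow> (\<Pi>\<^sub>E p\<in>J. space lborel)"
      by (auto simp: string_array_def J_def)
  qed
  let ?Q = "distr (density ?P (indicator (slice n k))) ?L (string_array n k)"
  have Q: "emeasure ?Q A = emeasure ?P {y \<in> slice n k. string_array n k y \<in> A}" if "A \<in> sets ?L" for A
  proof -
    have "emeasure ?Q A = emeasure (density ?P (indicator (slice n k))) (string_array n k -` A \<inter> space ?P)"
      using arr that by (subst emeasure_distr) auto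
    also have "\<dots> = emeasure ?P (slice n k \<inter> (string_array n k -` A \<inter> space ?P))"
      by (rule emeasure_restricted[OF slice_sets measurable_sets[OF arr that]])
    also have "slice n k \<inter> (string_array n k -` A \<inter> space ?P) = {y \<in> slice n k. string_array n k y \<in> A}"
      by (auto simp: slice_def)
    finally show ?thesis .
  qed
  have sets_eq: "sets (PiM J (\<lambda>_. ?U)) = sets ?L" by (rule sets_PiM_cong) auto
  have "?Q = PiM J (\<lambda>_. ?U)"
  proof (rule Ub.PiM_eqI)
    fix A :: "nat \<times> nat \<Rightarrow> real set" assume "\<And>p. p \<in> J \<Longrightarrow> A p \<in> sets ?U"
    then have A: "\<And>p. p \<in> J \<Longrightarrow> A p \<in> sets lborel" by simp
    let ?A = "\<lambda>i. A (i div k, Suc (i mod k))"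
    have A': "?A i \<in> sets lborel" if "i < n * k" for i
      using A bij that by (auto simp: bij_betw_def)
    have "{y \<in> slice n k. string_array n k y \<in> Pi\<^sub>E J A} = Pi\<^sub>E {..<n * k} (\<lambda>i. (?A i \<inter> {0..<1}) \<times> {i div k})"
      (is "?l = ?r")
    proof (intro equalityI subsetI)
      fix y assume y: "y \<in> ?l"
      have "y i \<in> (?A i \<inter> {0..<1}) \<times> {i div k}" if "i < n * k" for i
      proof -
        have iJ: "(i div k, Suc (i mod k)) \<in> J" using bij that by (auto simp: bij_betw_def)
        then have "string_array n k y (i div k, Suc (i mod k)) \<in> ?A i" using y by auto
        moreover have "string_array n k y (i div k, Suc (i mod k)) = fst (y i)"
          using iJ by (simp add: string_array_def J_def)
        moreover have "y i \<in> space (torus_measure n)" "snd (y i) = i div k"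
          using y that by (auto simp: slice_def space_PiM)
        ultimately show ?thesis by (cases "y i") (auto simp: space_torus_measure)
      qed
      then show "y \<in> ?r" using y by (auto simp: slice_def space_PiM PiE_iff)
    next
      fix y assume y: "y \<in> ?r"
      have yi: "fst (y i) \<in> ?A i" "fst (y i) \<in> {0..<1}" "snd (y i) = i div k" if "i < n * k" for i
        using y that by (auto simp: PiE_iff mem_Times_iff)
      have "y \<in> slice n k"
        using y yi lt by (auto simp: slice_def space_PiM PiE_iff space_torus_measure mem_Times_iff)
      moreover have "string_array n k y \<in> Pi\<^sub>E J A"
      proof (rule PiE_I)
        fix p assume "p \<in> J"
        then obtain i where i: "i < n * k" "p = (i div k, Suc (i mod k))"
          using bij by (auto simp: bij_betw_def)
        then have "string_array n k y p = fst (y i)"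
          using \<open>p \<in> J\<close> by (simp add: string_array_def J_def)
        then show "string_array n k y p \<in> A p" using yi i by simp
      qed (auto simp: string_array_def J_def)
      ultimately show "y \<in> ?l" by simp
    qed
    moreover have "Pi\<^sub>E J A \<in> sets ?L" using A by (intro sets_PiM_I_finite) auto
    ultimately have "emeasure ?Q (Pi\<^sub>E J A) = emeasure ?P (Pi\<^sub>E {..<n * k} (\<lambda>i. (?A i \<inter> {0..<1}) \<times> {i div k}))"
      using Q by simp
    also have "\<dots> = (\<Prod>i<n * k. emeasure (torus_measure n) ((?A i \<inter> {0..<1}) \<times> {i div k}))"
      using A' lt by (intro T.emeasure_PiM) (auto intro!: sets_torus_measure_string)
    also have "\<dots> = (\<Prod>i<n * k. emeasure ?U (?A i))"
      using A' lt by (intro prod.cong) (auto simp: emeasure_torus_measure_string U)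
    also have "\<dots> = (\<Prod>p\<in>J. emeasure ?U (A p))"
      by (rule prod.reindex_bij_betw[OF bij])
    finally show "emeasure ?Q (Pi\<^sub>E J A) = (\<Prod>p\<in>J. emeasure ?U (A p))" .
  qed (auto simp: sets_eq)
  also have "PiM J (\<lambda>_. ?U) = density ?L (indicator ?C)"
  proof (rule Ub.PiM_eqI[symmetric])
    fix A :: "nat \<times> nat \<Rightarrow> real set" assume "\<And>p. p \<in> J \<Longrightarrow> A p \<in> sets ?U"
    then have A: "\<And>p. p \<in> J \<Longrightarrow> A p \<in> sets lborel" by simp
    have "emeasure (density ?L (indicator ?C)) (Pi\<^sub>E J A) = emeasure ?L (?C \<inter> Pi\<^sub>E J A)"
      by (rule emeasure_restricted) (auto intro!: sets_PiM_I_finite A)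
    also have "?C \<inter> Pi\<^sub>E J A = Pi\<^sub>E J (\<lambda>p. A p \<inter> {0..<1})" by (auto simp: PiE_iff)
    also have "emeasure ?L \<dots> = (\<Prod>p\<in>J. emeasure lborel (A p \<inter> {0..<1}))"
      using A by (intro Lb.emeasure_PiM) auto
    finally show "emeasure (density ?L (indicator ?C)) (Pi\<^sub>E J A) = (\<Prod>p\<in>J. emeasure ?U (A p))"
      using A by (simp add: U)
  qed (auto simp: sets_eq)
  finally have Q_eq: "?Q = density ?L (indicator ?C)" .
  have B': "B \<in> sets ?L" "B \<subseteq> ?C" using B cube by (simp_all add: J_def)
  have "{y \<in> slice n k. string_array n k y \<in> B} = slice n k \<inter> (string_array n k -` B \<inter> space ?P)"
    by (auto simp: slice_def)
  then show "{y \<in> slice n k. string_array n k y \<in> B} \<in> sets ?P"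
    using slice_sets measurable_sets[OF arr B'(1)] by auto
  have "emeasure ?P {y \<in> slice n k. string_array n k y \<in> B} = emeasure (density ?L (indicator ?C)) B"
    using Q[OF B'(1)] Q_eq by simp
  also have "\<dots> = emeasure ?L (?C \<inter> B)"
    by (rule emeasure_restricted) (use B' in \<open>auto intro!: sets_PiM_I_finite\<close>)
  also have "?C \<inter> B = B" using B' by blast
  finally show "emeasure ?P {y \<in> slice n k. string_array n k y \<in> B} = emeasure (PiM ({..<n} \<times> {1..k}) (\<lambda>_. lborel)) B"
    by (simp add: J_def)
qed

section \<open>Integrals over increasing tuples\<close>

text \<open>For a point with distinct coordinates exactly one of the \<open>N!\<close> reorderings is increasing, and
  reordering preserves the product measure. Where coordinates coincide, \<open>f\<close> vanishes by assumption,
  so no null set has to be discarded.\<close>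

lemma integral_symmetric_function:
  fixes f :: "(nat \<Rightarrow> 'a) \<Rightarrow> 'b :: {banach, second_countable_topology}" and w :: "'a \<Rightarrow> real"
    and M :: "'a measure" and N :: nat
  defines "P \<equiv> PiM {..<N} (\<lambda>_. M)"
  defines "D \<equiv> {y \<in> space P. strict_mono_on {..<N} (\<lambda>i. w (y i))}"
  assumes M: "sigma_finite_measure M" and w: "w \<in> borel_measurable M"
    and int: "integrable P f"
    and sym: "\<And>p y. p permutes {..<N} \<Longrightarrow> y \<in> space P \<Longrightarrow> f (\<lambda>i. y (p i)) = f y"
    and distinct: "\<And>y. y \<in> space P \<Longrightarrow> f y \<noteq> 0 \<Longrightarrow> inj_on (\<lambda>i. w (y i)) {..<N}"
  shows "D \<in> sets P" and "integral\<^sup>L P f = fact N *\<^sub>R integral\<^sup>L P (\<lambda>y. indicator D y *\<^sub>R f y)"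
proof -
  have wi: "(\<lambda>y. w (y i)) \<in> borel_measurable P" if "i < N" for i
  proof -
    have "(\<lambda>y. y i) \<in> measurable P M"
      unfolding P_def by (rule measurable_component_singleton) (use that in simp)
    then show ?thesis by (rule measurable_compose) (rule w)
  qed
  have "Measurable.pred P (\<lambda>y. w (y i) < w (y j))" if "i < N" "j < N" for i j
    unfolding pred_def by (rule borel_measurable_less[OF wi[OF that(1)] wi[OF that(2)]])
  then have "Measurable.pred P (\<lambda>y. \<forall>i\<in>{..<N}. \<forall>j\<in>{..<N}. i < j \<longrightarrow> w (y i) < w (y j))"
    by (intro pred_intros_finite pred_intros_logic) auto
  moreover have "D = {y \<in> space P. \<forall>i\<in>{..<N}. \<forall>j\<in>{..<N}. i < j \<longrightarrow> w (y i) < w (y j)}"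
    unfolding D_def strict_mono_on_def by blast
  ultimately show D: "D \<in> sets P" unfolding pred_def by (simp only:)
  let ?g = "\<lambda>y. indicator D y *\<^sub>R f y"
  let ?S = "{p. p permutes {..<N}}"
  have g: "integrable P ?g" using D int by (rule integrable_mult_indicator)
  have meas: "(\<lambda>y i. y (p i)) \<in> measurable P P" and distr: "distr P P (\<lambda>y i. y (p i)) = P"
    if "p permutes {..<N}" for p
    using distr_PiM_permute[OF M finite_lessThan that] by (simp_all add: P_def)
  have decomp: "f y = (\<Sum>p\<in>?S. ?g (\<lambda>i. y (p i)))" if y: "y \<in> space P" for y
  proof -
    have "(\<Sum>p\<in>?S. ?g (\<lambda>i. y (p i)))
        = (\<Sum>p\<in>?S. if strict_mono_on {..<N} (\<lambda>i. w (y (p i))) then f y else 0)"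
      using measurable_space[OF meas y] sym y by (intro sum.cong) (auto simp: D_def indicator_def)
    also have "\<dots> = f y"
    proof (cases "f y = 0")
      case False
      from ex1_sorting_permutation[OF distinct[OF y False]] obtain p0
        where "\<And>p. p permutes {..<N} \<and> strict_mono_on {..<N} (\<lambda>i. w (y (p i))) \<longleftrightarrow> p = p0"
        by metis
      then have "{p \<in> ?S. strict_mono_on {..<N} (\<lambda>i. w (y (p i)))} = {p0}" by blast
      then show ?thesis
        by (subst sum.inter_filter[symmetric]) (auto simp: finite_permutations)
    next
      case True
      then show ?thesis by (simp only: if_cancel sum.neutral_const)
    qed
    finally show ?thesis by simp
  qed
  have "integral\<^sup>L P f = integral\<^sup>L P (\<lambda>y. \<Sum>p\<in>?S. ?g (\<lambda>i. y (p i)))"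
    using decomp by (rule Bochner_Integration.integral_cong[OF refl])
  also have "\<dots> = (\<Sum>p\<in>?S. integral\<^sup>L P (\<lambda>y. ?g (\<lambda>i. y (p i))))"
  proof (rule Bochner_Integration.integral_sum)
    fix p assume "p \<in> ?S"
    then have p: "p permutes {..<N}" by simp
    show "integrable P (\<lambda>y. ?g (\<lambda>i. y (p i)))"
      by (rule integrable_distr[OF meas[OF p]]) (simp only: distr[OF p] g)
  qed
  also have "\<dots> = (\<Sum>p\<in>?S. integral\<^sup>L P ?g)"
  proof (rule sum.cong[OF refl])
    fix p assume "p \<in> ?S"
    then have p: "p permutes {..<N}" by simp
    have "integral\<^sup>L (distr P P (\<lambda>y i. y (p i))) ?g = integral\<^sup>L P (\<lambda>y. ?g (\<lambda>i. y (p i)))"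
      by (rule integral_distr[OF meas[OF p] borel_measurable_integrable[OF g]])
    then show "integral\<^sup>L P (\<lambda>y. ?g (\<lambda>i. y (p i))) = integral\<^sup>L P ?g" by (simp only: distr[OF p])
  qed
  also have "\<dots> = fact N *\<^sub>R integral\<^sup>L P ?g"
    by (simp add: card_permutations[of "{..<N}" N] sum_constant_scaleR)
  finally show "integral\<^sup>L P f = fact N *\<^sub>R integral\<^sup>L P ?g" .
qed

text \<open>Concatenating the strings into \<open>[0, n)\<close> orders the points of the torus first by string and then by
  horizontal coordinate.\<close>

definition torus_coord :: "real \<times> nat \<Rightarrow> real" where
  "torus_coord a = real (snd a) + fst a"

lemma torus_coord_measurable [measurable]: "torus_coord \<in> borel_measurable (torus_measure n)"
proof -
  have "(\<lambda>a. real (snd a)) \<in> borel_measurable (torus_measure n)"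
    by (rule measurable_compose[OF measurable_snd_torus_measure]) simp
  then show ?thesis
    unfolding torus_coord_def[abs_def] by (rule borel_measurable_add) measurable
qed

lemma torus_coord_less_imp:
  assumes "fst a \<in> {0..<1}" "fst b \<in> {0..<1}" "torus_coord a < torus_coord b"
  shows "snd a \<le> snd b" and "snd a = snd b \<Longrightarrow> fst a < fst b"
  using assms by (auto simp: torus_coord_def)

lemma torus_coord_inj: "inj_on torus_coord (space (torus_measure n))"
proof (rule inj_onI)
  fix a b assume ab: "a \<in> space (torus_measure n)" "b \<in> space (torus_measure n)" "torus_coord a = torus_coord b"
  then have "real (snd a) + fst a = real (snd b) + fst b" "fst a \<in> {0..<1}" "fst b \<in> {0..<1}"
    by (auto simp: torus_coord_def space_torus_measure)
  moreover from this have "snd a = snd b" by auto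
  ultimately show "a = b" by (simp add: prod_eq_iff)
qed

definition increasing_points :: "nat \<Rightarrow> nat \<Rightarrow> (nat \<Rightarrow> real \<times> nat) set" where
  "increasing_points n N = {y \<in> space (PiM {..<N} (\<lambda>_. torus_measure n)).
     strict_mono_on {..<N} (\<lambda>i. torus_coord (y i))}"

lemma sigma_finite_torus_measure: "sigma_finite_measure (torus_measure n)"
  using finite_measure_torus_measure by (rule finite_measure.axioms(1))

text \<open>This bound is the source of all convergence: the \<open>N!\<close> reorderings of the increasing tuples are disjoint
  sets of equal measure in a space of measure \<open>n ^ N\<close>.\<close>

lemma measure_increasing_points:
  shows "increasing_points n N \<in> sets (PiM {..<N} (\<lambda>_. torus_measure n))"
    and "measure (PiM {..<N} (\<lambda>_. torus_measure n)) (increasing_points n N) \<le> real n ^ N / fact N"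
proof -
  define P where "P = PiM {..<N} (\<lambda>_. torus_measure n)"
  define D where "D = increasing_points n N"
  define E where "E = {y \<in> space P. inj_on (\<lambda>i. torus_coord (y i)) {..<N}}"
  interpret P: finite_measure P
    unfolding P_def by (rule finite_measure_PiM[OF finite_measure_torus_measure]) simp
  have wi: "(\<lambda>y. torus_coord (y i)) \<in> borel_measurable P" if "i < N" for i
  proof -
    have "(\<lambda>y. y i) \<in> measurable P (torus_measure n)"
      unfolding P_def by (rule measurable_component_singleton) (use that in simp)
    then show ?thesis by (rule measurable_compose) (rule torus_coord_measurable)
  qed
  have "Measurable.pred P (\<lambda>y. torus_coord (y i) = torus_coord (y j))" if "i < N" "j < N" for i j
    unfolding pred_def by (rule borel_measurable_eq[OF wi[OF that(1)] wi[OF that(2)]])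
  then have "Measurable.pred P (\<lambda>y. \<forall>i\<in>{..<N}. \<forall>j\<in>{..<N}. torus_coord (y i) = torus_coord (y j) \<longrightarrow> i = j)"
    by (intro pred_intros_finite pred_intros_logic) auto
  then have E: "E \<in> sets P" unfolding E_def inj_on_def pred_def .
  let ?f = "indicator E :: _ \<Rightarrow> real"
  have int: "integrable P ?f" using E by (intro integrable_real_indicator) (simp_all add: less_top[symmetric])
  have sym: "?f (\<lambda>i. y (p i)) = ?f y" if p: "p permutes {..<N}" and y: "y \<in> space P" for p y
  proof -
    have "(\<lambda>i. y (p i)) \<in> space P"
      using measurable_space[OF distr_PiM_permute(1)[OF sigma_finite_torus_measure finite_lessThan p]] y
      by (simp add: P_def)
    moreover have "inj_on (\<lambda>i. torus_coord (y (p i))) {..<N} \<longleftrightarrow> inj_on (\<lambda>i. torus_coord (y i)) {..<N}"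
      using comp_inj_on_iff[OF permutes_inj_on[OF p, of "{..<N}"], of "\<lambda>i. torus_coord (y i)"]
      by (simp add: permutes_image[OF p] o_def)
    ultimately show ?thesis using y by (simp add: E_def indicator_def)
  qed
  have distinct: "inj_on (\<lambda>i. torus_coord (y i)) {..<N}" if "?f y \<noteq> 0" for y
    using that by (simp add: E_def indicator_def split: if_splits)
  note * = integral_symmetric_function[OF sigma_finite_torus_measure[of n] torus_coord_measurable,
      where N = N and f = ?f, folded P_def increasing_points_def D_def, OF int sym distinct]
  show D: "increasing_points n N \<in> sets (PiM {..<N} (\<lambda>_. torus_measure n))"
    using * by (simp add: P_def D_def)
  have "D \<subseteq> E"
    unfolding D_def E_def increasing_points_def P_def[symmetric]
    by (auto intro: strict_mono_on_imp_inj_on)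
  then have "(\<lambda>y. indicator D y *\<^sub>R ?f y) = indicator D"
    by (auto simp: indicator_def fun_eq_iff)
  moreover have "D \<subseteq> space P" "E \<subseteq> space P" by (auto simp: D_def E_def increasing_points_def P_def)
  ultimately have "measure P E = fact N * measure P D"
    using *(2) D E by (simp add: Int_absorb2)
  moreover have "measure P E \<le> measure P (space P)" by (rule P.bounded_measure)
  moreover have "measure P (space P) = real n ^ N"
    unfolding P_def by (subst finite_measure_PiM(2)[OF finite_measure_torus_measure])
      (simp_all add: measure_torus_measure)
  ultimately show "measure (PiM {..<N} (\<lambda>_. torus_measure n)) (increasing_points n N) \<le> real n ^ N / fact N"
    by (simp add: P_def D_def field_simps)
qed

text \<open>Inside a block of \<open>k\<close> indices the coordinates increase by assumption, and at the end of a block the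
  string label jumps by one, which exceeds any difference of coordinates in \<open>[0, 1)\<close>.\<close>

lemma slice_increasing:
  assumes y: "y \<in> slice n k"
    and inc: "\<And>h j. h < n \<Longrightarrow> j \<in> {1..<k} \<Longrightarrow> string_array n k y (h, j) < string_array n k y (h, j + 1)"
  shows "y \<in> increasing_points n (n * k)"
proof -
  have sp: "y \<in> space (PiM {..<n * k} (\<lambda>_. torus_measure n))" and slice: "\<And>i. i < n * k \<Longrightarrow> snd (y i) = i div k"
    using y by (auto simp: slice_def)
  have range: "fst (y i) \<in> {0..<1}" if "i < n * k" for i
    using sp that by (auto simp: space_PiM PiE_iff space_torus_measure mem_Times_iff)
  have step: "torus_coord (y i) < torus_coord (y (Suc i))" if i: "Suc i < n * k" for i
  proof (cases "Suc (i mod k) = k")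
    case True
    then have "Suc i div k = Suc (i div k)" by (simp add: div_Suc mod_Suc)
    then show ?thesis
      using slice[of i] slice[of "Suc i"] range[of i] range[of "Suc i"] i by (simp add: torus_coord_def)
  next
    case False
    have k: "k > 0" using i by (cases k) auto
    define h j where "h = i div k" and "j = i mod k"
    have ij: "i = h * k + j" by (simp add: h_def j_def)
    have "j < k" using k by (simp add: j_def)
    with False have j: "Suc j < k" by (simp add: j_def)
    have h: "h < n" using i k by (simp add: h_def div_less_iff_less_mult)
    have "Suc i div k = h" using False by (simp add: div_Suc mod_Suc h_def)
    moreover have "fst (y i) < fst (y (Suc i))"
      using inc[of h "Suc j"] h j by (simp add: string_array_def ij)
    ultimately show ?thesis
      using slice[of i] slice[of "Suc i"] i by (simp add: torus_coord_def h_def)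
  qed
  have "torus_coord (y i) < torus_coord (y j)" if "i < j" "j < n * k" for i j
    using that
  proof (induction j)
    case (Suc j)
    then show ?case using step[of j] by (cases "i = j") force+
  qed simp
  then show ?thesis using sp by (auto simp: increasing_points_def strict_mono_on_def)
qed

text \<open>Increasing tuples list the strings one after another, and a nonzero determinant forces equally many
  points on each, so the string labels are determined.\<close>

lemma increasing_points_nonzero_imp_slice:
  assumes n: "n > 0" and k: "k > 0" and y: "y \<in> increasing_points n (n * k)"
    and nz: "kernel_det (step_kernel n q) (n * k) y \<noteq> 0"
  shows "y \<in> slice n k"
    and "h < n \<Longrightarrow> j \<in> {1..<k} \<Longrightarrow> string_array n k y (h, j) < string_array n k y (h, j + 1)"
proof -
  have sp: "y \<in> space (PiM {..<n * k} (\<lambda>_. torus_measure n))"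
    and mono: "\<And>i j. i < j \<Longrightarrow> j < n * k \<Longrightarrow> torus_coord (y i) < torus_coord (y j)"
    using y by (auto simp: increasing_points_def strict_mono_on_def)
  have range: "fst (y i) \<in> {0..<1}" "snd (y i) < n" if "i < n * k" for i
    using sp that by (auto simp: space_PiM PiE_iff space_torus_measure mem_Times_iff)
  have "\<exists>k'. n * k = n * k' \<and> (\<forall>h<n. card {i. i < n * k \<and> snd (y i) = h} = k')"
    by (rule kernel_det_step_kernel_nonzero[OF nz n range(2)]) (assumption, blast)
  then obtain k' where k': "n * k = n * k'" "\<forall>h<n. card {i. i < n * k \<and> snd (y i) = h} = k'"
    by blast
  from k'(1) n have "k' = k" by simp
  with k'(2) have fibre: "card {i. i < n * k \<and> snd (y i) = h} = k" if "h < n" for h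
    using that by blast
  have smono: "snd (y i) \<le> snd (y j)" if "i \<le> j" "j < n * k" for i j
    using torus_coord_less_imp(1)[OF range(1) range(1) mono, of i j] that by (cases "i = j") auto
  have slice: "snd (y i) = i div k" if "i < n * k" for i
    by (rule equal_fibres_imp_div[OF smono range(2) fibre that])
  then show "y \<in> slice n k" using sp by (simp add: slice_def)
  assume h: "h < n" and j: "j \<in> {1..<k}"
  obtain j' where j': "j = Suc j'" "Suc j' < k" using j by (cases j) auto
  have "Suc h * k \<le> n * k" using h by (intro mult_right_mono) auto
  then have b: "h * k + Suc j' < n * k" using j' by simp
  have "(h * k + j') div k = h" "(h * k + Suc j') div k = h"
    by (rule div_nat_eqI; use j' in \<open>simp add: mult.commute\<close>)+
  then have "snd (y (h * k + j')) = snd (y (h * k + Suc j'))"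
    using slice b by simp
  then have "fst (y (h * k + j')) < fst (y (h * k + Suc j'))"
    using torus_coord_less_imp(2)[OF range(1) range(1) mono] b by simp
  then show "string_array n k y (h, j) < string_array n k y (h, j + 1)"
    using h j' by (simp add: string_array_def)
qed

section \<open>Volumes of bead configurations in the Fredholm expansion\<close>

text \<open>The bead configurations, listed string by string and from left to right.\<close>

definition config_points :: "nat \<Rightarrow> nat \<Rightarrow> nat \<Rightarrow> (nat \<Rightarrow> real \<times> nat) set" where
  "config_points n k l = {y \<in> slice n k. string_array n k y \<in> bead_arrays n k l}"

lemma config_points:
  assumes n: "n > 0" and k: "k > 0"
  shows "config_points n k l \<in> sets (PiM {..<n * k} (\<lambda>_. torus_measure n))"
    and "measure (PiM {..<n * k} (\<lambda>_. torus_measure n)) (config_points n k l) = bead_vol n k l"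
    and "config_points n k l \<subseteq> increasing_points n (n * k)"
proof -
  have nk: "n \<ge> 1" "k \<ge> 1" using n k by simp_all
  note eq = bead_arrays_eq[OF nk]
  have cube: "bead_arrays n k l \<subseteq> Pi\<^sub>E ({..<n} \<times> {1..k}) (\<lambda>_. {0..<1})"
    unfolding eq by blast
  note em = emeasure_slice_string_array[OF k bead_arrays_measurable[OF nk] cube]
  show "config_points n k l \<in> sets (PiM {..<n * k} (\<lambda>_. torus_measure n))"
    unfolding config_points_def by (rule em(1))
  show "measure (PiM {..<n * k} (\<lambda>_. torus_measure n)) (config_points n k l) = bead_vol n k l"
    using k em(2) by (simp add: bead_vol_def measure_def config_points_def)
  show "config_points n k l \<subseteq> increasing_points n (n * k)"
  proof
    fix y assume "y \<in> config_points n k l"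
    then have "y \<in> slice n k"
      and "\<forall>h<n. \<forall>j\<in>{1..<k}. string_array n k y (h, j) < string_array n k y (h, j + 1)"
      unfolding config_points_def eq by blast+
    then show "y \<in> increasing_points n (n * k)" by (intro slice_increasing) blast+
  qed
qed

text \<open>The factor \<open>2 ^ n\<close> is there for \<open>k = 0\<close>, where the volume is a binomial coefficient by convention.\<close>

lemma bead_vol_le:
  assumes n: "n > 0"
  shows "bead_vol n k l \<le> 2 ^ n * (real n ^ (n * k) / fact (n * k))" and "0 \<le> bead_vol n k l"
proof -
  show "0 \<le> bead_vol n k l" by (simp add: bead_vol_def)
  show "bead_vol n k l \<le> 2 ^ n * (real n ^ (n * k) / fact (n * k))"
  proof (cases "k = 0")
    case True
    have "real (n choose l) \<le> real (2 ^ n)" by (rule of_nat_mono[OF binomial_le_pow2])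
    then show ?thesis using True by (simp add: bead_vol_def)
  next
    case False
    then have k: "k > 0" by simp
    let ?P = "PiM {..<n * k} (\<lambda>_. torus_measure n)"
    interpret finite_measure ?P
      by (rule finite_measure_PiM[OF finite_measure_torus_measure]) simp
    have "bead_vol n k l \<le> measure ?P (increasing_points n (n * k))"
      using finite_measure_mono[OF config_points(3)[OF n k] measure_increasing_points(1)]
      by (simp add: config_points(2)[OF n k])
    also have "\<dots> \<le> 1 * (real n ^ (n * k) / fact (n * k))"
      using measure_increasing_points(2) by simp
    also have "\<dots> \<le> 2 ^ n * (real n ^ (n * k) / fact (n * k))"
      by (intro mult_right_mono) simp_all
    finally show ?thesis .
  qed
qed

text \<open>On increasing tuples the determinant is a weighted indicator of the bead configurations: elsewhere
  either the strings carry different numbers of points or two neighbouring strings do not interlace.\<close>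

lemma kernel_det_step_kernel_increasing:
  assumes n: "n > 0" and k: "k > 0" and y: "y \<in> space (PiM {..<n * k} (\<lambda>_. torus_measure n))"
  shows "indicator (increasing_points n (n * k)) y *\<^sub>R kernel_det (step_kernel n q) (n * k) y =
    (\<Sum>l\<le>n. indicator (config_points n k l) y *\<^sub>R
      ((- 1) ^ ((n + 1) * k) * (1 - q) ^ (n * (k - 1)) * ((- 1) ^ (k - 1) * q) ^ l))"
proof -
  have nk: "n \<ge> 1" "k \<ge> 1" using n k by simp_all
  define x where "x h j = string_array n k y (h, j)" for h j
  define inc where "inc \<longleftrightarrow> (\<forall>h<n. \<forall>j\<in>{1..<k}. x h j < x h (j + 1))"
  define I where "I \<longleftrightarrow> (\<forall>h<n. interlaced k (x h) (x ((h + 1) mod n)))"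
  define L where "L = card {h. h < n \<and> x h 1 < x ((h + n - 1) mod n) 1}"
  define c where "c = (- 1) ^ ((n + 1) * k) * (1 - q) ^ (n * (k - 1))"
  have cp: "y \<in> config_points n k l \<longleftrightarrow> y \<in> slice n k \<and> inc \<and> I \<and> L = l" for l
  proof -
    have "string_array n k y \<in> ({..<n} \<times> {1..k}) \<rightarrow>\<^sub>E {0..<1}" if "y \<in> slice n k"
    proof (rule PiE_I)
      fix p assume "p \<in> {..<n} \<times> {1..k}"
      then obtain h j where p: "p = (h, Suc j)" "h < n" "j < k" by (cases p; cases "snd p") auto
      have "Suc h * k \<le> n * k" using p by (intro mult_right_mono) auto
      then have "h * k + j < n * k" using p by simp
      then have "y (h * k + j) \<in> space (torus_measure n)" using y by (auto simp: space_PiM)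
      then have "fst (y (h * k + j)) \<in> {0..<1}" by (auto simp: space_torus_measure mem_Times_iff)
      then show "string_array n k y p \<in> {0..<1}" using p by (simp add: string_array_def)
    next
      fix p assume "p \<notin> {..<n} \<times> {1..k}"
      then show "string_array n k y p = undefined"
        by (simp only: string_array_def restrict_apply if_False)
    qed
    then show ?thesis
      unfolding config_points_def bead_arrays_eq[OF nk] inc_def I_def L_def x_def by blast
  qed
  show ?thesis
  proof (cases "y \<in> slice n k \<and> inc")
    case True
    have "y \<in> increasing_points n (n * k)"
      using slice_increasing True unfolding inc_def x_def by blast
    moreover have "kernel_det (step_kernel n q) (n * k) y = c * (if I then ((- 1) ^ (k - 1) * q) ^ L else 0)"
      unfolding c_def I_def L_def
    proof (rule kernel_det_step_kernel_sliced[OF n k])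
      show "snd (y i) = i div k" if "i < n * k" for i using True that by (simp add: slice_def)
      show "x h (Suc j) = fst (y (h * k + j))" if "h < n" "j < k" for h j
        using that by (simp add: x_def string_array_def)
      show "x h j < x h (j + 1)" if "h < n" "j \<in> {1..<k}" for h j
        using True that unfolding inc_def by blast
    qed
    moreover have "(\<Sum>l\<le>n. indicator (config_points n k l) y *\<^sub>R (c * ((- 1) ^ (k - 1) * q) ^ l))
        = c * (if I then ((- 1) ^ (k - 1) * q) ^ L else 0)"
    proof -
      have "card {h. h < n \<and> x h 1 < x ((h + n - 1) mod n) 1} \<le> card {..<n}"
        by (rule card_mono) auto
      then have "L \<le> n" by (simp add: L_def)
      have "(\<Sum>l\<le>n. indicator (config_points n k l) y *\<^sub>R (c * ((- 1) ^ (k - 1) * q) ^ l))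
          = (\<Sum>l\<le>n. if L = l then (if I then c * ((- 1) ^ (k - 1) * q) ^ l else 0) else 0)"
        by (rule sum.cong[OF refl]) (simp add: indicator_def cp True)
      also have "\<dots> = (if I then c * ((- 1) ^ (k - 1) * q) ^ L else 0)"
        using \<open>L \<le> n\<close> by (simp only: sum.delta' finite_atMost atMost_iff if_True)
      finally show ?thesis by simp
    qed
    ultimately show ?thesis by (simp add: c_def)
  next
    case False
    then have "(\<Sum>l\<le>n. indicator (config_points n k l) y *\<^sub>R (c * ((- 1) ^ (k - 1) * q) ^ l)) = 0"
      by (intro sum.neutral ballI) (auto simp: cp)
    moreover have "indicator (increasing_points n (n * k)) y *\<^sub>R kernel_det (step_kernel n q) (n * k) y = 0"
    proof (rule ccontr)
      assume nz: "indicator (increasing_points n (n * k)) y *\<^sub>R kernel_det (step_kernel n q) (n * k) y \<noteq> 0"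
      then have "y \<in> increasing_points n (n * k)" "kernel_det (step_kernel n q) (n * k) y \<noteq> 0"
        by (auto simp: indicator_def split: if_splits)
      note * = increasing_points_nonzero_imp_slice[OF n k this]
      then show False using False unfolding inc_def x_def by blast
    qed
    ultimately show ?thesis by (simp only: c_def)
  qed
qed

lemma kernel_det_step_kernel_measurable:
  "kernel_det (step_kernel n q) N \<in> borel_measurable (PiM {..<N} (\<lambda>_. torus_measure n))"
proof -
  let ?P = "PiM {..<N} (\<lambda>_. torus_measure n)"
  have factor: "(\<lambda>y. step_kernel n q (y i) (y j)) \<in> borel_measurable ?P" if ij: "i < N" "j < N" for i j
  proof -
    have comp: "(\<lambda>y. y i) \<in> measurable ?P (torus_measure n)" "(\<lambda>y. y j) \<in> measurable ?P (torus_measure n)"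
      by (rule measurable_component_singleton; use ij in simp)+
    note [measurable] = measurable_compose[OF comp(1) measurable_fst_torus_measure]
      measurable_compose[OF comp(2) measurable_fst_torus_measure]
      measurable_compose[OF comp(1) measurable_snd_torus_measure]
      measurable_compose[OF comp(2) measurable_snd_torus_measure]
    have "(\<lambda>y. if snd (y j) = (snd (y i) + 1) mod n then (if fst (y j) < fst (y i) then q else 1) else 0)
        \<in> borel_measurable ?P"
      by measurable
    also have "(\<lambda>y. if snd (y j) = (snd (y i) + 1) mod n then (if fst (y j) < fst (y i) then q else 1) else 0)
        = (\<lambda>y. step_kernel n q (y i) (y j))"
      by (auto simp: step_kernel_def split_beta)
    finally show ?thesis .
  qed
  have "(\<lambda>y. \<Sum>p | p permutes {..<N}. signof p * (\<Prod>i<N. step_kernel n q (y i) (y (p i)))) \<in> borel_measurable ?P"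
  proof (intro borel_measurable_sum borel_measurable_times borel_measurable_const borel_measurable_prod factor)
    fix p i assume "p \<in> {p. p permutes {..<N}}" "i \<in> {..<N}"
    then show "i < N" "p i < N" using permutes_in_image[of p "{..<N}" i] by auto
  qed
  then show ?thesis by (simp add: kernel_det_expand[abs_def])
qed

lemma kernel_det_step_kernel_integrable:
  "integrable (PiM {..<N} (\<lambda>_. torus_measure n)) (kernel_det (step_kernel n q) N)"
proof -
  interpret finite_measure "PiM {..<N} (\<lambda>_. torus_measure n)"
    by (rule finite_measure_PiM[OF finite_measure_torus_measure]) simp
  have step: "norm (step_kernel n q a b) \<le> max 1 (norm q)" for a b
    by (auto simp: step_kernel_def split_beta)
  have "norm (kernel_det (step_kernel n q) N y) \<le> (\<Sum>p | p permutes {..<N}. max 1 (norm q) ^ N)" for y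
    unfolding kernel_det_expand
  proof (rule sum_norm_le)
    fix p
    have "norm (signof p * (\<Prod>i<N. step_kernel n q (y i) (y (p i)))) = (\<Prod>i<N. norm (step_kernel n q (y i) (y (p i))))"
      by (cases p rule: sign_cases) (simp_all add: norm_mult prod_norm)
    also have "\<dots> \<le> (\<Prod>i<N. max 1 (norm q))" by (intro prod_mono) (simp add: step)
    finally show "norm (signof p * (\<Prod>i<N. step_kernel n q (y i) (y (p i)))) \<le> max 1 (norm q) ^ N" by simp
  qed
  then show ?thesis
    by (intro integrable_const_bound[OF AE_I2 kernel_det_step_kernel_measurable])
qed

text \<open>The factor \<open>N!\<close> from the reduction to increasing tuples cancels the one in the Fredholm expansion.\<close>

lemma integral_kernel_det_step_kernel:
  assumes n: "n > 0"
  shows "k > 0 \<Longrightarrow> (LINT y|PiM {..<n * k} (\<lambda>_. torus_measure n). kernel_det (step_kernel n q) (n * k) y) =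
      fact (n * k) * ((- 1) ^ ((n + 1) * k) * (1 - q) ^ (n * (k - 1)) *
        (\<Sum>l\<le>n. ((- 1) ^ (k - 1) * q) ^ l * of_real (bead_vol n k l)))"
    and "\<not> n dvd N \<Longrightarrow> (LINT y|PiM {..<N} (\<lambda>_. torus_measure n). kernel_det (step_kernel n q) N y) = 0"
proof -
  have snd: "snd (y i) < n" if "y \<in> space (PiM {..<N} (\<lambda>_. torus_measure n))" "i < N" for y i N
    using that by (auto simp: space_PiM PiE_iff space_torus_measure mem_Times_iff)
  have "kernel_det (step_kernel n q) N y = 0"
    if "\<not> n dvd N" "y \<in> space (PiM {..<N} (\<lambda>_. torus_measure n))" for y
  proof (rule ccontr)
    assume "kernel_det (step_kernel n q) N y \<noteq> 0"
    from kernel_det_step_kernel_nonzero[OF this n snd[OF that(2)]] have "n dvd N"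
      by (metis dvd_triv_left)
    then show False using that(1) by simp
  qed
  then show "(LINT y|PiM {..<N} (\<lambda>_. torus_measure n). kernel_det (step_kernel n q) N y) = 0" if "\<not> n dvd N"
    using that Bochner_Integration.integral_cong[OF refl, of "PiM {..<N} (\<lambda>_. torus_measure n)"
      "kernel_det (step_kernel n q) N" "\<lambda>_. 0"] by simp
next
  assume k: "k > 0"
  define N where "N = n * k"
  define P where "P = PiM {..<N} (\<lambda>_. torus_measure n)"
  define c where "c = (- 1) ^ ((n + 1) * k) * (1 - q) ^ (n * (k - 1))"
  interpret finite_measure P
    unfolding P_def by (rule finite_measure_PiM[OF finite_measure_torus_measure]) simp
  have sym: "kernel_det (step_kernel n q) N (\<lambda>i. y (p i)) = kernel_det (step_kernel n q) N y"
    if "p permutes {..<N}" "y \<in> space P" for p y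
    using that(1) by (rule kernel_det_permute)
  have distinct: "inj_on (\<lambda>i. torus_coord (y i)) {..<N}"
    if "y \<in> space P" "kernel_det (step_kernel n q) N y \<noteq> 0" for y
  proof (rule inj_onI)
    fix i j assume ij: "i \<in> {..<N}" "j \<in> {..<N}" "torus_coord (y i) = torus_coord (y j)"
    have "y i \<in> space (torus_measure n)" "y j \<in> space (torus_measure n)"
      using that(1) ij(1,2) by (auto simp: P_def space_PiM)
    then have "y i = y j" using inj_onD[OF torus_coord_inj ij(3)] by blast
    then show "i = j" using that(2) kernel_det_coincident[of i N j y] ij(1,2) by auto
  qed
  have cp: "config_points n k l \<in> sets P" "measure P (config_points n k l) = bead_vol n k l" for l
    using config_points[OF n k] by (simp_all add: P_def N_def)
  have "integral\<^sup>L P (kernel_det (step_kernel n q) N) =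
      fact N *\<^sub>R integral\<^sup>L P (\<lambda>y. indicator (increasing_points n N) y *\<^sub>R kernel_det (step_kernel n q) N y)"
    unfolding increasing_points_def P_def
    by (rule integral_symmetric_function(2)[OF sigma_finite_torus_measure torus_coord_measurable
        kernel_det_step_kernel_integrable])
      (use sym distinct in \<open>simp_all add: P_def\<close>)
  also have "integral\<^sup>L P (\<lambda>y. indicator (increasing_points n N) y *\<^sub>R kernel_det (step_kernel n q) N y) =
      integral\<^sup>L P (\<lambda>y. \<Sum>l\<le>n. indicator (config_points n k l) y *\<^sub>R (c * ((- 1) ^ (k - 1) * q) ^ l))"
    by (rule Bochner_Integration.integral_cong[OF refl])
      (simp only: N_def P_def c_def kernel_det_step_kernel_increasing[OF n k])
  also have "\<dots> = (\<Sum>l\<le>n. bead_vol n k l *\<^sub>R (c * ((- 1) ^ (k - 1) * q) ^ l))"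
  proof -
    have "has_bochner_integral P (\<lambda>y. \<Sum>l\<le>n. indicator (config_points n k l) y *\<^sub>R (c * ((- 1) ^ (k - 1) * q) ^ l))
        (\<Sum>l\<le>n. measure P (config_points n k l) *\<^sub>R (c * ((- 1) ^ (k - 1) * q) ^ l))"
      by (intro has_bochner_integral_sum has_bochner_integral_indicator cp)
        (simp add: emeasure_eq_measure ennreal_less_top)
    then show ?thesis unfolding cp(2) by (rule has_bochner_integral_integral_eq)
  qed
  also have "\<dots> = c * (\<Sum>l\<le>n. ((- 1) ^ (k - 1) * q) ^ l * of_real (bead_vol n k l))"
    by (simp add: sum_distrib_left scaleR_conv_of_real mult_ac)
  finally show "(LINT y|PiM {..<n * k} (\<lambda>_. torus_measure n). kernel_det (step_kernel n q) (n * k) y) =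
      fact (n * k) * ((- 1) ^ ((n + 1) * k) * (1 - q) ^ (n * (k - 1)) *
        (\<Sum>l\<le>n. ((- 1) ^ (k - 1) * q) ^ l * of_real (bead_vol n k l)))"
    by (simp add: P_def N_def c_def scaleR_conv_of_real)
qed

text \<open>The prefactor \<open>exp (\<theta> * pi * \<i> / n)\<close> enters with the power \<open>n * k\<close> and so leaves the sign
  \<open>(-1) ^ (\<theta> * k)\<close>; the denominators \<open>1 - q\<close> cancel up to one per string.\<close>

lemma fredholm_term_bead_kernel:
  fixes \<beta> T :: complex
  assumes n: "n > 0" and q: "exp (- \<beta>) \<noteq> 1"
  shows "\<not> n dvd N \<Longrightarrow> fredholm_term n T (bead_kernel n \<beta> \<theta>) N = 0"
    and "fredholm_term n T (bead_kernel n \<beta> \<theta>) 0 = 1"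
    and "k > 0 \<Longrightarrow> fredholm_term n T (bead_kernel n \<beta> \<theta>) (n * k) =
      T ^ (n * k) * (- 1) ^ ((\<theta> + n + 1) * k) / (1 - exp (- \<beta>)) ^ n *
      (\<Sum>l\<le>n. ((- 1) ^ (k - 1) * exp (- \<beta>)) ^ l * of_real (bead_vol n k l))"
    and "integrable (PiM {..<N} (\<lambda>_. torus_measure n)) (kernel_det (bead_kernel n \<beta> \<theta>) N)"
proof -
  define z where "z = exp (of_nat \<theta> * of_real pi * \<i> / of_nat n)"
  let ?q = "exp (- \<beta>)"
  have eq: "kernel_det (bead_kernel n \<beta> \<theta>) N = (\<lambda>y. (z / (1 - ?q)) ^ N * kernel_det (step_kernel n ?q) N y)" for N
    by (rule ext) (simp only: kernel_det_bead_kernel z_def)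
  show "integrable (PiM {..<N} (\<lambda>_. torus_measure n)) (kernel_det (bead_kernel n \<beta> \<theta>) N)"
    unfolding eq by (intro integrable_mult_right kernel_det_step_kernel_integrable)
  have ft: "fredholm_term n T (bead_kernel n \<beta> \<theta>) N = T ^ N / fact N * ((z / (1 - ?q)) ^ N *
      (LINT y|PiM {..<N} (\<lambda>_. torus_measure n). kernel_det (step_kernel n ?q) N y))" for N
    unfolding fredholm_term_def eq
    by (subst Bochner_Integration.integral_mult_right[OF kernel_det_step_kernel_integrable]) (rule refl)
  show "fredholm_term n T (bead_kernel n \<beta> \<theta>) N = 0" if "\<not> n dvd N"
    unfolding ft integral_kernel_det_step_kernel(2)[OF n that] by simp
  show "fredholm_term n T (bead_kernel n \<beta> \<theta>) 0 = 1"
  proof -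
    have "measure (PiM {..<0 :: nat} (\<lambda>_. torus_measure n)) (space (PiM {..<0 :: nat} (\<lambda>_. torus_measure n))) = 1"
      by (subst finite_measure_PiM(2)[OF finite_measure_torus_measure]) simp_all
    then show ?thesis by (simp add: fredholm_term_def kernel_det_def)
  qed
  assume k: "k > 0"
  have "z ^ n = exp (of_nat \<theta> * (of_real pi * \<i>))"
    using n by (simp add: z_def mult.assoc flip: exp_of_nat_mult)
  then have zn: "z ^ n = (- 1) ^ \<theta>" by (simp only: exp_of_nat_mult exp_pi_i)
  then have zN: "z ^ (n * k) = (- 1) ^ (\<theta> * k)" by (simp add: power_mult)
  have qN: "(1 - ?q) ^ (n * k) = (1 - ?q) ^ n * (1 - ?q) ^ (n * (k - 1))"
    using k by (cases k) (simp_all add: power_add)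
  show "fredholm_term n T (bead_kernel n \<beta> \<theta>) (n * k) =
      T ^ (n * k) * (- 1) ^ ((\<theta> + n + 1) * k) / (1 - exp (- \<beta>)) ^ n *
      (\<Sum>l\<le>n. ((- 1) ^ (k - 1) * exp (- \<beta>)) ^ l * of_real (bead_vol n k l))"
    unfolding ft integral_kernel_det_step_kernel(1)[OF n k] power_divide zN qN
    using q by (simp add: field_simps power_add)
qed

section \<open>Convergence and the sum over the four twists\<close>

text \<open>The exponential series for \<open>X\<close> dominates its subseries over the multiples of \<open>n\<close>.\<close>

lemma summable_bound:
  fixes f :: "nat \<Rightarrow> complex" and X K :: real
  assumes n: "n > 0" and X: "X \<ge> 0"
    and f: "\<And>k. k > 0 \<Longrightarrow> norm (f k) \<le> K * (X ^ (n * k) / fact (n * k))"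
  shows "summable (\<lambda>k. norm (f k))"
proof -
  have "summable (\<lambda>N. X ^ N / fact N)" using summable_exp[of X] by (simp add: field_simps)
  then have "summable ((\<lambda>N. X ^ N / fact N) \<circ> (\<lambda>k. n * k))"
    by (rule summable_reindex) (use n X in \<open>auto simp: inj_on_def\<close>)
  then have "summable (\<lambda>k. K * (X ^ (n * k) / fact (n * k)))"
    by (intro summable_mult) (simp add: o_def)
  then show ?thesis
    by (rule summable_comparison_test'[where N = 1]) (use f in simp)
qed

lemma sum_bead_vol_le:
  fixes c :: "nat \<Rightarrow> complex"
  assumes n: "n > 0"
  shows "norm (\<Sum>l\<le>n. c l * of_real (bead_vol n k l)) \<le>
    (\<Sum>l\<le>n. norm (c l)) * 2 ^ n * (real n ^ (n * k) / fact (n * k))"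
proof -
  have "norm (\<Sum>l\<le>n. c l * of_real (bead_vol n k l)) \<le> (\<Sum>l\<le>n. norm (c l) * (2 ^ n * (real n ^ (n * k) / fact (n * k))))"
  proof (rule sum_norm_le)
    fix l
    have "norm (of_real (bead_vol n k l) :: complex) \<le> 2 ^ n * (real n ^ (n * k) / fact (n * k))"
      using bead_vol_le[OF n, of k l] by simp
    then show "norm (c l * of_real (bead_vol n k l)) \<le> norm (c l) * (2 ^ n * (real n ^ (n * k) / fact (n * k)))"
      unfolding norm_mult by (rule mult_left_mono) simp
  qed
  then show ?thesis by (simp only: sum_distrib_right mult.assoc)
qed

lemma summable_partition_term:
  assumes n: "n > 0"
  shows "summable (\<lambda>k. norm (partition_term n lam T k))"
proof (rule summable_bound[OF n, where X = "norm T * n"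
      and K = "(\<Sum>l\<le>n. norm (exp (- lam * of_nat l))) * 2 ^ n"])
  fix k :: nat
  have "partition_term n lam T k = T ^ (n * k) * (\<Sum>l\<le>n. exp (- lam * of_nat l) * of_real (bead_vol n k l))"
    by (simp add: partition_term_def sum_distrib_left mult.assoc)
  then have "norm (partition_term n lam T k)
      = norm T ^ (n * k) * norm (\<Sum>l\<le>n. exp (- lam * of_nat l) * of_real (bead_vol n k l))"
    by (simp add: norm_mult norm_power)
  also have "\<dots> \<le> norm T ^ (n * k) * ((\<Sum>l\<le>n. norm (exp (- lam * of_nat l))) * 2 ^ n * (real n ^ (n * k) / fact (n * k)))"
    by (intro mult_left_mono sum_bead_vol_le[OF n]) simp
  finally show "norm (partition_term n lam T k) \<le>
      (\<Sum>l\<le>n. norm (exp (- lam * of_nat l))) * 2 ^ n * ((norm T * n) ^ (n * k) / fact (n * k))"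
    by (simp add: power_mult_distrib mult_ac)
qed simp

text \<open>Only the orders \<open>n * k\<close> contribute, so convergence and value can be read off from this subsequence.\<close>

lemma fredholm_det_bead_kernel:
  fixes \<beta> T :: complex
  assumes n: "n > 0" and q: "exp (- \<beta>) \<noteq> 1"
  shows "fredholm_converges n T (bead_kernel n \<beta> \<theta>)"
    and "(\<lambda>k. fredholm_term n T (bead_kernel n \<beta> \<theta>) (n * k)) sums fredholm_det n T (bead_kernel n \<beta> \<theta>)"
proof -
  let ?F = "fredholm_term n T (bead_kernel n \<beta> \<theta>)"
  let ?q = "exp (- \<beta>)"
  have mono: "strict_mono (\<lambda>k. n * k)" using n by (simp add: strict_mono_def)
  have zero: "?F N = 0" if "N \<notin> range (\<lambda>k. n * k)" for N
    by (rule fredholm_term_bead_kernel(1)[OF n q]) (use that in \<open>auto elim!: dvdE\<close>)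
  have "summable (\<lambda>k. norm (?F (n * k)))"
  proof (rule summable_bound[OF n, where X = "norm T * n"
        and K = "(\<Sum>l\<le>n. norm ?q ^ l) * 2 ^ n / norm (1 - ?q) ^ n"])
    fix k :: nat assume k: "k > 0"
    have "norm (?F (n * k)) = norm T ^ (n * k) / norm (1 - ?q) ^ n *
        norm (\<Sum>l\<le>n. ((- 1) ^ (k - 1) * ?q) ^ l * of_real (bead_vol n k l))"
      unfolding fredholm_term_bead_kernel(3)[OF n q k]
      by (simp only: norm_mult norm_divide norm_power norm_minus_cancel norm_one power_one mult_1_right)
    also have "\<dots> \<le> norm T ^ (n * k) / norm (1 - ?q) ^ n *
        ((\<Sum>l\<le>n. norm (((- 1) ^ (k - 1) * ?q) ^ l)) * 2 ^ n * (real n ^ (n * k) / fact (n * k)))"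
      by (intro mult_left_mono sum_bead_vol_le[OF n]) simp
    also have "(\<Sum>l\<le>n. norm (((- 1) ^ (k - 1) * ?q) ^ l)) = (\<Sum>l\<le>n. norm ?q ^ l)"
      by (simp only: norm_mult norm_power norm_minus_cancel norm_one power_one mult_1_left)
    finally show "norm (?F (n * k)) \<le>
        (\<Sum>l\<le>n. norm ?q ^ l) * 2 ^ n / norm (1 - ?q) ^ n * ((norm T * n) ^ (n * k) / fact (n * k))"
      by (simp add: power_mult_distrib mult_ac)
  qed simp
  then have summ: "summable (\<lambda>N. norm (?F N))"
    using summable_mono_reindex[OF mono, of "\<lambda>N. norm (?F N)"] zero by simp
  then show "fredholm_converges n T (bead_kernel n \<beta> \<theta>)"
    using fredholm_term_bead_kernel(4)[OF n q] by (simp add: fredholm_converges_def)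
  have "?F sums fredholm_det n T (bead_kernel n \<beta> \<theta>)"
    unfolding fredholm_det_def using summable_norm_cancel[OF summ] by (rule summable_sums)
  then show "(\<lambda>k. ?F (n * k)) sums fredholm_det n T (bead_kernel n \<beta> \<theta>)"
    using sums_mono_reindex[OF mono, of ?F] zero by blast
qed

lemma exp_theta_shift: "exp (- (lam + of_nat \<theta> * of_real pi * \<i>)) = (- 1) ^ \<theta> * exp (- lam :: complex)"
proof -
  have "exp (- (lam + of_nat \<theta> * of_real pi * \<i>)) = exp (- lam) * exp (of_nat \<theta> * (- (of_real pi * \<i>)))"
    by (simp add: exp_add[symmetric] algebra_simps)
  also have "exp (of_nat \<theta> * (- (of_real pi * \<i>)) :: complex) = (- 1) ^ \<theta>"
    by (cases "even \<theta>") (simp_all add: exp_of_nat_mult exp_minus exp_pi_i)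
  finally show ?thesis by (simp add: mult.commute)
qed

text \<open>Put \<open>a = \<theta>1 + 1\<close> and \<open>b = \<theta>2 + n + 1\<close>. Modulo \<open>2\<close> the exponent of \<open>-1\<close> is \<open>a * b + b * k + (k + a) * l\<close>. The sum over
  \<open>b\<close> vanishes unless \<open>a\<close> and \<open>k\<close> have the same parity, and then the remaining exponent \<open>(k + a) * l\<close> is even. So
  the four signs, each with weight \<open>1 / 2\<close>, add up to one.\<close>

lemma spin_sum:
  fixes n k l :: nat
  assumes "k > 0"
  shows "(\<Sum>(\<theta>1, \<theta>2)\<in>{0, 1} \<times> {0, 1}. 1 / 2 * (- 1) ^ ((\<theta>1 + 1) * (\<theta>2 + n + 1)) *
      (- 1) ^ ((\<theta>2 + n + 1) * k) * ((- 1) ^ (k - 1) * (- 1) ^ \<theta>1) ^ l) = (1 :: complex)"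
proof -
  obtain m where k: "k = Suc m" using assms by (cases k) auto
  have "(\<Sum>(\<theta>1, \<theta>2)\<in>{0, 1} \<times> {0, 1}. f \<theta>1 \<theta>2) = f 0 0 + f 0 1 + f 1 0 + f 1 (1 :: nat)"
    for f :: "nat \<Rightarrow> nat \<Rightarrow> complex"
    by (simp add: sum.cartesian_product[symmetric])
  then show ?thesis
    by (cases "even n"; cases "even m"; cases "even l")
      (simp_all add: k minus_one_power_iff)
qed

text \<open>For \<open>k = 0\<close> all Fredholm terms are \<open>1\<close>; the sum over \<open>\<theta>2\<close> kills \<open>\<theta>1 = 0\<close> and leaves \<open>(1 + exp (- lam)) ^ n\<close>, which
  is the generating function of the binomial coefficients. For \<open>k > 0\<close> the coefficient
  \<^const>\<open>theta_coeff\<close> cancels the denominator of the Fredholm term, and the signs sum to one.\<close>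

lemma partition_term_eq:
  assumes n: "n > 0" and lam: "exp (- lam) \<noteq> 1" "exp (- lam) \<noteq> - 1"
  shows "partition_term n lam T k = (\<Sum>(\<theta>1, \<theta>2)\<in>{0, 1} \<times> {0, 1}. theta_coeff n lam \<theta>1 \<theta>2 *
      fredholm_term n T (bead_kernel n (lam + of_nat \<theta>1 * of_real pi * \<i>) \<theta>2) (n * k))"
proof -
  let ?e = "exp (- lam)"
  let ?F = "\<lambda>\<theta>1 \<theta>2. fredholm_term n T (bead_kernel n (lam + of_nat \<theta>1 * of_real pi * \<i>) \<theta>2)"
  have q: "exp (- (lam + of_nat \<theta>1 * of_real pi * \<i>)) \<noteq> 1" if "\<theta>1 \<in> {0, 1}" for \<theta>1
    using that lam unfolding exp_theta_shift by (auto simp: minus_equation_iff[of ?e])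
  show ?thesis
  proof (cases "k = 0")
    case True
    have F: "?F \<theta>1 \<theta>2 0 = 1" if "\<theta>1 \<in> {0, 1}" for \<theta>1 \<theta>2
      by (rule fredholm_term_bead_kernel(2)[OF n q[OF that]])
    have "(\<Sum>(\<theta>1, \<theta>2)\<in>{0, 1} \<times> {0, 1}. theta_coeff n lam \<theta>1 \<theta>2 * ?F \<theta>1 \<theta>2 (n * k)) =
        (\<Sum>(\<theta>1, \<theta>2)\<in>{0, 1} \<times> {0, 1}. theta_coeff n lam \<theta>1 \<theta>2)"
    proof (rule sum.cong[OF refl])
      fix \<theta> :: "nat \<times> nat" assume "\<theta> \<in> {0, 1} \<times> {0, 1}"
      then obtain \<theta>1 \<theta>2 where th: "\<theta> = (\<theta>1, \<theta>2)" "\<theta>1 \<in> {0, 1}" by blast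
      show "(case \<theta> of (\<theta>1, \<theta>2) \<Rightarrow> theta_coeff n lam \<theta>1 \<theta>2 * ?F \<theta>1 \<theta>2 (n * k)) =
          (case \<theta> of (\<theta>1, \<theta>2) \<Rightarrow> theta_coeff n lam \<theta>1 \<theta>2)"
        unfolding th(1) prod.case by (simp only: True mult_0_right F[OF th(2)] mult_1_right)
    qed
    also have "\<dots> = (?e + 1) ^ n"
      by (cases "even n") (simp_all add: sum.cartesian_product[symmetric] theta_coeff_def minus_one_power_iff add.commute)
    also have "\<dots> = (\<Sum>l\<le>n. of_nat (n choose l) * ?e ^ l)"
      by (simp add: binomial_ring)
    also have "\<dots> = partition_term n lam T k"
      using True by (simp add: partition_term_def bead_vol_def mult.commute flip: exp_of_nat_mult)
    finally show ?thesis by simp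
  next
    case False
    then have k: "k > 0" by simp
    have summand: "theta_coeff n lam \<theta>1 \<theta>2 * ?F \<theta>1 \<theta>2 (n * k) =
        (\<Sum>l\<le>n. T ^ (n * k) * ?e ^ l * of_real (bead_vol n k l) *
          (1 / 2 * (- 1) ^ ((\<theta>1 + 1) * (\<theta>2 + n + 1)) * (- 1) ^ ((\<theta>2 + n + 1) * k) * ((- 1) ^ (k - 1) * (- 1) ^ \<theta>1) ^ l))"
      if "\<theta>1 \<in> {0, 1}" for \<theta>1 \<theta>2
    proof -
      have nz: "(1 - (- 1) ^ \<theta>1 * ?e) ^ n \<noteq> 0" using q[OF that] unfolding exp_theta_shift by simp
      have cancel: "c * u * (A / u * S) = c * A * S" if "u \<noteq> 0" for c u A S :: complex
        using that by simp
      have "theta_coeff n lam \<theta>1 \<theta>2 * ?F \<theta>1 \<theta>2 (n * k) =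
          1 / 2 * (- 1) ^ ((\<theta>1 + 1) * (\<theta>2 + n + 1)) * (T ^ (n * k) * (- 1) ^ ((\<theta>2 + n + 1) * k)) *
          (\<Sum>l\<le>n. ((- 1) ^ (k - 1) * ((- 1) ^ \<theta>1 * ?e)) ^ l * of_real (bead_vol n k l))"
        unfolding fredholm_term_bead_kernel(3)[OF n q[OF that] k] exp_theta_shift theta_coeff_def
        by (rule cancel[OF nz])
      also have "\<dots> = (\<Sum>l\<le>n. T ^ (n * k) * ?e ^ l * of_real (bead_vol n k l) *
          (1 / 2 * (- 1) ^ ((\<theta>1 + 1) * (\<theta>2 + n + 1)) * (- 1) ^ ((\<theta>2 + n + 1) * k) * ((- 1) ^ (k - 1) * (- 1) ^ \<theta>1) ^ l))"
        unfolding sum_distrib_left by (intro sum.cong refl) (simp only: power_mult_distrib mult_ac)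
      finally show ?thesis .
    qed
    have "(\<Sum>(\<theta>1, \<theta>2)\<in>{0, 1} \<times> {0, 1}. theta_coeff n lam \<theta>1 \<theta>2 * ?F \<theta>1 \<theta>2 (n * k)) =
        (\<Sum>\<theta>\<in>{0, 1} \<times> {0, 1}. \<Sum>l\<le>n. T ^ (n * k) * ?e ^ l * of_real (bead_vol n k l) *
          (case \<theta> of (\<theta>1, \<theta>2) \<Rightarrow> 1 / 2 * (- 1) ^ ((\<theta>1 + 1) * (\<theta>2 + n + 1)) * (- 1) ^ ((\<theta>2 + n + 1) * k) * ((- 1) ^ (k - 1) * (- 1) ^ \<theta>1) ^ l))"
    proof (rule sum.cong[OF refl])
      fix \<theta> :: "nat \<times> nat" assume "\<theta> \<in> {0, 1} \<times> {0, 1}"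
      then obtain \<theta>1 \<theta>2 where th: "\<theta> = (\<theta>1, \<theta>2)" "\<theta>1 \<in> {0, 1}" by blast
      show "(case \<theta> of (\<theta>1, \<theta>2) \<Rightarrow> theta_coeff n lam \<theta>1 \<theta>2 * ?F \<theta>1 \<theta>2 (n * k)) =
        (\<Sum>l\<le>n. T ^ (n * k) * ?e ^ l * of_real (bead_vol n k l) *
          (case \<theta> of (\<theta>1, \<theta>2) \<Rightarrow> 1 / 2 * (- 1) ^ ((\<theta>1 + 1) * (\<theta>2 + n + 1)) * (- 1) ^ ((\<theta>2 + n + 1) * k) * ((- 1) ^ (k - 1) * (- 1) ^ \<theta>1) ^ l))"
        unfolding th(1) prod.case by (rule summand[OF th(2)])
    qed
    also have "\<dots> = (\<Sum>l\<le>n. T ^ (n * k) * ?e ^ l * of_real (bead_vol n k l))"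
      by (subst sum.swap) (simp only: spin_sum[OF k] mult_1_right flip: sum_distrib_left)
    also have "\<dots> = partition_term n lam T k"
      by (simp add: partition_term_def mult.commute flip: exp_of_nat_mult)
    finally show ?thesis by simp
  qed
qed

theorem theorem1p1:
  fixes n :: nat and T lam :: complex
  assumes "n \<ge> 2" and "exp (- lam) \<noteq> 1" and "exp (- lam) \<noteq> - 1"
  shows "summable (\<lambda>k. norm (partition_term n lam T k)) \<and>
    (\<forall>\<theta>1\<in>{0, 1}. \<forall>\<theta>2\<in>{0, 1}.
       fredholm_converges n T (bead_kernel n (lam + of_nat \<theta>1 * of_real pi * \<i>) \<theta>2)) \<and>
    partition_function n lam T =
      (\<Sum>(\<theta>1, \<theta>2)\<in>{0, 1} \<times> {0, 1}.
         theta_coeff n lam \<theta>1 \<theta>2 *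
         fredholm_det n T (bead_kernel n (lam + of_nat \<theta>1 * of_real pi * \<i>) \<theta>2))"
proof (intro conjI ballI)
  have n: "n > 0" using assms(1) by simp
  let ?F = "\<lambda>\<theta>1 \<theta>2. fredholm_term n T (bead_kernel n (lam + of_nat \<theta>1 * of_real pi * \<i>) \<theta>2)"
  let ?D = "\<lambda>\<theta>1 \<theta>2. fredholm_det n T (bead_kernel n (lam + of_nat \<theta>1 * of_real pi * \<i>) \<theta>2)"
  have q: "exp (- (lam + of_nat \<theta>1 * of_real pi * \<i>)) \<noteq> 1" if "\<theta>1 \<in> {0, 1}" for \<theta>1
    using that assms(2,3) unfolding exp_theta_shift by (auto simp: minus_equation_iff[of "exp (- lam)"])
  show "summable (\<lambda>k. norm (partition_term n lam T k))" by (rule summable_partition_term[OF n])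
  show "fredholm_converges n T (bead_kernel n (lam + of_nat \<theta>1 * of_real pi * \<i>) \<theta>2)"
    if "\<theta>1 \<in> {0, 1}" for \<theta>1 \<theta>2
    by (rule fredholm_det_bead_kernel(1)[OF n q[OF that]])
  have "(\<lambda>k. \<Sum>(\<theta>1, \<theta>2)\<in>{0, 1} \<times> {0, 1}. theta_coeff n lam \<theta>1 \<theta>2 * ?F \<theta>1 \<theta>2 (n * k)) sums
      (\<Sum>(\<theta>1, \<theta>2)\<in>{0, 1} \<times> {0, 1}. theta_coeff n lam \<theta>1 \<theta>2 * ?D \<theta>1 \<theta>2)"
  proof (rule sums_sum)
    fix \<theta> :: "nat \<times> nat" assume "\<theta> \<in> {0, 1} \<times> {0, 1}"
    then obtain \<theta>1 \<theta>2 where th: "\<theta> = (\<theta>1, \<theta>2)" "\<theta>1 \<in> {0, 1}" by blast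
    show "(\<lambda>k. case \<theta> of (\<theta>1, \<theta>2) \<Rightarrow> theta_coeff n lam \<theta>1 \<theta>2 * ?F \<theta>1 \<theta>2 (n * k)) sums
        (case \<theta> of (\<theta>1, \<theta>2) \<Rightarrow> theta_coeff n lam \<theta>1 \<theta>2 * ?D \<theta>1 \<theta>2)"
      unfolding th(1) prod.case by (intro sums_mult fredholm_det_bead_kernel(2)[OF n q[OF th(2)]])
  qed
  then show "partition_function n lam T = (\<Sum>(\<theta>1, \<theta>2)\<in>{0, 1} \<times> {0, 1}. theta_coeff n lam \<theta>1 \<theta>2 * ?D \<theta>1 \<theta>2)"
    unfolding partition_function_def partition_term_eq[OF n assms(2,3)] by (rule sums_unique[symmetric])
qed

end
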